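(* Let $0 < R \leq \infty$ and $I = [0, R)$ or $I=(-R,R)$. Fix integers $n \geq 2$, $0 \leq k < n-1$, and $2 \leq l \leq n$. Suppose $f : I \to \mathbb{R}$ belongs to $C^k(I)$. Then the following are equivalent: \begin{enumerate} \item $f[A] \in \mathbb{S}_n^k$ for all $A \in \mathbb{P}_n^l(I)$; \item $f(x) = \sum_{t=1}^r a_t x^{i_t}$ (for some integer $r\ge 0$) for some $a_t \in \mathbb{R}$ and some distinct integers $i_t \in \mathbb{Z}_{\geq 0}$ such that $$\sum_{t=1}^r \binom{i_t+l-1}{l-1} \leq k.$$ \end{enumerate} Similarly, $f[A] \in \mathbb{P}_n^k$ for all $A \in \mathbb{P}_n^l(I)$ if and only if $f$ satisfies (2) with $a_t \geq 0$ for all $t$. Moreover, if $I = [0,R)$ and either $k=0$ or $k \leq n-3$, then in this last equivalence (characterizing when $f[A]\in\mathbb{P}_n^k$ for all $A \in \mathbb{P}_n^l(I)$) the assumption that $f \in C^k(I)$ is not required.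
   Context: For $J \subset \mathbb{R}$, $\mathbb{S}_n(J)$ is the set of $n \times n$ real symmetric matrices with entries in $J$, and $\mathbb{P}_n(J) \subset \mathbb{S}_n(J)$ is the subset of positive semidefinite matrices. $\mathbb{S}_n^k(J)$ and $\mathbb{P}_n^k(J)$ denote the subsets of matrices of rank at most $k$. When $J = \mathbb{R}$ it is omitted from the notation. For a matrix $A=(a_{ij})$ with entries in the domain of $f$, $f[A] := (f(a_{ij}))$ (entrywise application). An empty sum is zero. *)

theory Defs
  imports
    Complex_Main
    "HOL-Library.Extended_Real"
    "Jordan_Normal_Form.DL_Rank"
begin

definition symmetric_mats :: "nat \<Rightarrow> real set \<Rightarrow> real mat set" where
  "symmetric_mats n J =
    {A \<in> carrier_mat n n. transpose_mat A = A \<and> elements_mat A \<subseteq> J}"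

definition psd_mats :: "nat \<Rightarrow> real set \<Rightarrow> real mat set" where
  "psd_mats n J =
    {A \<in> symmetric_mats n J. \<forall>v \<in> carrier_vec n. 0 \<le> v \<bullet> (A *\<^sub>v v)}"

text \<open>The argument \<open>n\<close> of \<open>vec_space.rank\<close> is the dimension of the space containing the columns.\<close>

definition symmetric_mats_rank_le :: "nat \<Rightarrow> nat \<Rightarrow> real set \<Rightarrow> real mat set" where
  "symmetric_mats_rank_le n k J = {A \<in> symmetric_mats n J. vec_space.rank n A \<le> k}"

definition psd_mats_rank_le :: "nat \<Rightarrow> nat \<Rightarrow> real set \<Rightarrow> real mat set" where
  "psd_mats_rank_le n k J = {A \<in> psd_mats n J. vec_space.rank n A \<le> k}"

text \<open>
  Membership in \<open>C\<^sup>k(S)\<close> for an interval \<open>S\<close>: \<open>g j\<close> is the \<open>j\<close>-th derivative of \<open>f\<close> on \<open>S\<close>,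
  one-sided at an endpoint belonging to \<open>S\<close>. Only the values of \<open>f\<close> on \<open>S\<close> matter.
\<close>

definition C_k_on :: "nat \<Rightarrow> (real \<Rightarrow> real) \<Rightarrow> real set \<Rightarrow> bool" where
  "C_k_on k f S \<longleftrightarrow>
    (\<exists>g :: nat \<Rightarrow> real \<Rightarrow> real.
      (\<forall>x\<in>S. g 0 x = f x) \<and>
      (\<forall>j<k. \<forall>x\<in>S. (g j has_real_derivative g (Suc j) x) (at x within S)) \<and>
      continuous_on S (g k))"

text \<open>
  On \<open>S\<close>, \<open>f\<close> is a polynomial with coefficients in \<open>C\<close> and distinct exponents \<open>i 1, \<dots>, i r\<close>
  whose weights \<open>(i t + l - 1) choose (l - 1)\<close> add up to at most \<open>k\<close>; here \<open>x ^ 0 = 1\<close> also for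
  \<open>x = 0\<close>, and \<open>r = 0\<close> gives the zero function. Intended for \<open>l \<ge> 1\<close>.
\<close>

definition weighted_polynomial_on ::
    "real set \<Rightarrow> nat \<Rightarrow> nat \<Rightarrow> (real \<Rightarrow> real) \<Rightarrow> real set \<Rightarrow> bool" where
  "weighted_polynomial_on C l k f S \<longleftrightarrow>
    (\<exists>(r::nat) (a :: nat \<Rightarrow> real) (i :: nat \<Rightarrow> nat).
      (\<forall>t\<in>{1..r}. a t \<in> C) \<and>
      inj_on i {1..r} \<and>
      (\<forall>x\<in>S. f x = (\<Sum>t=1..r. a t * x ^ i t)) \<and>
      (\<Sum>t=1..r. (i t + l - 1) choose (l - 1)) \<le> k)"

end

theory Submission
  imports "HOL-Analysis.Analysis" Defs
begin

text \<open>
  The functions in question are studied through the kernel \<open>(x, y) \<mapsto> f (dot l x y)\<close> on vectors in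
  dimension \<open>l\<close>: positive semidefinite matrices of rank at most \<open>l\<close> are exactly the Gram matrices of
  such vectors (\<open>psd_mat_rank_le_is_gram\<close>).
  
  If \<open>f x = x ^ i\<close>, the multinomial theorem writes the kernel as a positive combination of
  \<open>(i + l - 1) choose (l - 1)\<close> products of monomials, which gives the rank bound and the positivity of
  \<open>f[A]\<close> for weighted polynomials (\<open>weighted_polynomial_preserves_rank\<close>).
  
  Conversely, suppose that all matrices \<open>f[A]\<close> have rank at most \<open>k\<close>. Since \<open>k + 2 \<le> n\<close>, all principal
  minors of the kernel of sizes \<open>k + 1\<close> and \<open>k + 2\<close> vanish, and a Schur complement argument shows that
  the kernel itself is a sum of \<open>k\<close> products \<open>B x m * C y m\<close>
  (\<open>symmetric_kernel_decomposition\<close>, \<open>rank_preserver_kernel_rank_le\<close>). Two coordinates suffice to exploit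
  this: the \<open>k + 1\<close> vectors \<open>(s, j h)\<close> satisfy a linear dependence in this factorization, and pairing
  it with arbitrary vectors yields \<open>(\<Sum>j\<le>k. q j * f (x + j * \<delta>)) = 0\<close> for all \<open>x\<close> in an
  interval and all small \<open>\<delta> > 0\<close>, with fixed coefficients \<open>q\<close> (\<open>core_dilation_relation\<close>). Integrating such a relation in \<open>\<delta>\<close>
  makes a continuous \<open>f\<close> differentiable; differentiating it in \<open>\<delta>\<close> gives a shorter relation for \<open>f'\<close>.
  By induction \<open>f\<close> is a polynomial (\<open>dilation_relation_imp_polynomial\<close>).
  
  For a polynomial, distinct monomials in \<open>l\<close> variables are independent, so the rank of the kernel
  is the number of monomials whose degree is an exponent of \<open>f\<close>, and this is the sum of the weights
  (\<open>polynomial_weight_bound\<close>). If the matrices \<open>f[A]\<close> are positive semidefinite, then the kernel is so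
  on any number of points because it is governed by one Gram matrix of at most \<open>k\<close> points, and the
  coefficients of \<open>f\<close> are values of its quadratic form (\<open>psd_preserver_coeffs_nonneg\<close>).
  
  The regularity that starts the induction is continuity. In the positive semidefinite case on
  \<open>[0, R)\<close> it is a consequence of positivity: the \<open>2 \<times> 2\<close> matrices make \<open>f\<close> monotone; a monotone function with such a relation is
  continuous on the open interval (\<open>mono_dilation_relation_imp_continuous\<close>), and a \<open>3 \<times> 3\<close> matrix
  determines its value at \<open>0\<close> (\<open>psd_preserver_is_polynomial\<close>).
\<close>

section \<open>Rank as the length of a factorization\<close>

text \<open>
  A coefficient matrix with fewer rows than columns, padded with zero rows to a square matrix, is
  singular.
\<close>

lemma underdetermined_system_has_nonzero_solution:
  fixes C :: "nat \<Rightarrow> nat \<Rightarrow> real"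
  assumes "k < r"
  shows "\<exists>c. (\<exists>j<r. c j \<noteq> 0) \<and> (\<forall>m<k. (\<Sum>j<r. C m j * c j) = 0)"
proof -
  define M where "M = mat\<^sub>r r r (\<lambda>i. if i = k then 0\<^sub>v r else Matrix.vec r (\<lambda>j. if i < k then C i j else 0))"
  have M: "M \<in> carrier_mat r r" by (simp add: M_def)
  have "Determinant.det M = 0"
    unfolding M_def by (rule det_row_0[where c = "\<lambda>i. Matrix.vec r (\<lambda>j. if i < k then C i j else 0)"]) (use assms in auto)
  then obtain v where v: "v \<in> carrier_vec r" "v \<noteq> 0\<^sub>v r" "M *\<^sub>v v = 0\<^sub>v r"
    using det_0_iff_vec_prod_zero_field[OF M] by blast
  have "(\<Sum>j<r. C m j * vec_index v j) = 0" if "m < k" for m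
  proof -
    have "vec_index (M *\<^sub>v v) m = 0" using v(3) that assms by simp
    thus ?thesis using that assms v(1) M
      by (simp add: M_def scalar_prod_def atLeast0LessThan)
  qed
  moreover have "\<exists>j<r. vec_index v j \<noteq> 0"
  proof (rule ccontr)
    assume "\<not> ?thesis"
    hence "v = 0\<^sub>v r" using v(1) by (intro eq_vecI) auto
    thus False using v(2) by simp
  qed
  ultimately show ?thesis by blast
qed

text \<open>
  Each summand of the factorization is a matrix of rank at most one, and rank is subadditive. With
  the lemma after it, this translates rank bounds into finite sums of products, the only form in
  which ranks are used below: it also makes sense for kernels on infinite sets.
\<close>

lemma rank_le_if_factors:
  fixes A :: "real mat"
  assumes A: "A \<in> carrier_mat n n"
    and fac: "\<And>i j. i < n \<Longrightarrow> j < n \<Longrightarrow> A $$ (i, j) = (\<Sum>m<k. B i m * C m j)"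
  shows "vec_space.rank n A \<le> k"
  using A fac
proof (induction k arbitrary: A)
  case 0
  hence "A = 0\<^sub>m n n" by (intro eq_matI) auto
  thus ?case by (simp add: vec_space.rank_0I)
next
  case (Suc k)
  define A1 where "A1 = mat n n (\<lambda>(i, j). \<Sum>m<k. B i m * C m j)"
  define A2 where "A2 = mat n n (\<lambda>(i, j). B i k * C k j)"
  have "A = A1 + A2" using Suc.prems by (intro eq_matI) (auto simp: A1_def A2_def)
  moreover have "vec_space.rank n A1 \<le> k" by (rule Suc.IH) (auto simp: A1_def)
  moreover have "vec_space.rank n A2 \<le> 1"
    by (rule vec_space.rank_le_1_product_entries[where f = "\<lambda>i. B i k" and g = "C k"])
      (auto simp: A2_def)
  moreover have "vec_space.rank n (A1 + A2) \<le> vec_space.rank n A1 + vec_space.rank n A2"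
    by (rule vec_space.rank_subadditive) (auto simp: A1_def A2_def)
  ultimately show ?case by simp
qed

lemma factors_if_rank_le:
  fixes A :: "real mat"
  assumes A: "A \<in> carrier_mat n n" and rank: "vec_space.rank n A \<le> k"
  shows "\<exists>B C. \<forall>i<n. \<forall>j<n. A $$ (i, j) = (\<Sum>m<k. B i m * C m j)"
proof -
  interpret vec_space "TYPE(real)" n .
  have sub: "set (cols A) \<subseteq> carrier_vec n" using A cols_dim by blast
  obtain S where S: "maximal S (\<lambda>T. T \<subseteq> set (cols A) \<and> lin_indpt T)"
    using maximal_exists_superset[of "set (cols A)" "(\<lambda>T. T \<subseteq> set (cols A) \<and> lin_indpt T)" "{}"]
    using finite_lin_indpt2 by auto
  hence SA: "S \<subseteq> set (cols A)" and li: "lin_indpt S" by (auto simp: maximal_def)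
  have fin: "finite S" using SA finite_subset by blast
  have card: "card S \<le> k" using rank_card_indpt[OF A S] rank by simp
  \<comment> \<open>A maximal independent set of columns spans all columns; the spanning columns and the
    coordinates in them are the two factors.\<close>
  have span: "v \<in> span S" if "v \<in> set (cols A)" for v
  proof (rule ccontr)
    assume "v \<notin> span S"
    have "lin_indpt (S \<union> {v})"
      using lin_dep_iff_in_span[of S v] SA li sub that \<open>v \<notin> span S\<close> span_mem[of S v] by auto
    moreover have "v \<notin> S" using \<open>v \<notin> span S\<close> SA sub span_mem[of S v] by auto
    ultimately show False using S SA that unfolding maximal_def by auto
  qed
  obtain e where e: "bij_betw e {..<card S} S"
    using ex_bij_betw_nat_finite[OF fin] atLeast0LessThan by metis
  have "\<exists>a. \<forall>i<n. A $$ (i, j) = (\<Sum>s\<in>S. a s * vec_index s i)" if "j < n" for j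
  proof -
    have "col A j \<in> set (cols A)" using that A by (auto simp: cols_def)
    from span[OF this] obtain a where "col A j = lincomb a S"
      using finite_in_span[OF fin, of "col A j"] SA sub by (metis subset_trans)
    hence "A $$ (i, j) = (\<Sum>s\<in>S. a s * vec_index s i)" if "i < n" for i
      using lincomb_index[of i S a] that \<open>j < n\<close> A SA sub by (metis col_def index_col index_vec carrier_matD subset_trans)
    thus ?thesis by blast
  qed
  then obtain a where a: "\<And>i j. i < n \<Longrightarrow> j < n \<Longrightarrow> A $$ (i, j) = (\<Sum>s\<in>S. a j s * vec_index s i)"
    by metis
  have "A $$ (i, j) = (\<Sum>m<k. (if m < card S then vec_index (e m) i else 0) * a j (e m))"
    if "i < n" "j < n" for i j
  proof -
    have "A $$ (i, j) = (\<Sum>m<card S. a j (e m) * vec_index (e m) i)"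
      unfolding a[OF that] by (rule sum.reindex_bij_betw[OF e, symmetric])
    also have "\<dots> = (\<Sum>m<k. (if m < card S then vec_index (e m) i else 0) * a j (e m))"
      by (rule sum.mono_neutral_cong_left) (use card in auto)
    finally show ?thesis .
  qed
  thus ?thesis
    by (intro exI[of _ "\<lambda>i m. if m < card S then vec_index (e m) i else 0"] exI[of _ "\<lambda>m j. a j (e m)"]) auto
qed

section \<open>Symmetric kernels of finite rank\<close>

text \<open>
  Nonsingularity of the Gram matrix of the points \<open>p 0, \<dots>, p (r - 1)\<close> with respect to the kernel
  \<open>K\<close>, phrased as triviality of its null space so that kernels on arbitrary sets need no matrices.
\<close>

definition nondegenerate :: "('a \<Rightarrow> 'a \<Rightarrow> real) \<Rightarrow> (nat \<Rightarrow> 'a) \<Rightarrow> nat \<Rightarrow> bool" where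
  "nondegenerate K p r \<longleftrightarrow>
    (\<forall>c. (\<forall>i<r. (\<Sum>j<r. K (p i) (p j) * c j) = 0) \<longrightarrow> (\<forall>j<r. c j = 0))"

text \<open>
  Every point \<open>x\<close> has coordinates \<open>d x\<close> with respect to a maximal nondegenerate tuple \<open>p\<close>, and the
  kernel is the bilinear form of the Gram matrix of \<open>p\<close> in these coordinates. The
  Schur complement \<open>s\<close> of that matrix vanishes on the diagonal since adding one point \<open>x\<close> makes the
  matrix singular; adding two points \<open>x\<close>, \<open>y\<close> leaves the complement with zero diagonal and
  determinant \<open>- (s x y)\<^sup>2\<close>, which must vanish too. So it is enough to control principal minors of size
  at most \<open>k + 2\<close>. The same decomposition transfers positivity of one finite Gram matrix to all
  of them.
\<close>

lemma symmetric_kernel_decomposition: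
  fixes K :: "'a \<Rightarrow> 'a \<Rightarrow> real"
  assumes sym: "\<And>x y. x \<in> X \<Longrightarrow> y \<in> X \<Longrightarrow> K x y = K y x"
    and bound: "\<And>r p. r \<le> k + 2 \<Longrightarrow> \<forall>i<r. p i \<in> X \<Longrightarrow> nondegenerate K p r \<Longrightarrow> r \<le> k"
  shows "\<exists>r p d. r \<le> k \<and> (\<forall>i<r. p i \<in> X) \<and>
    (\<forall>x\<in>X. \<forall>y\<in>X. K x y = (\<Sum>i<r. \<Sum>j<r. d x i * K (p i) (p j) * d y j))"
proof -
  define P where "P r \<longleftrightarrow> r \<le> k \<and> (\<exists>p. (\<forall>i<r. p i \<in> X) \<and> nondegenerate K p r)" for r
  have "P 0" by (simp add: P_def nondegenerate_def)
  moreover have "\<forall>r. P r \<longrightarrow> r \<le> k" by (simp add: P_def)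
  ultimately obtain r where "P r" and max: "\<And>r'. P r' \<Longrightarrow> r' \<le> r"
    using ex_has_greatest_nat[of P 0 "\<lambda>r. r" "Suc k"] by (auto simp: less_Suc_eq_le)
  then obtain p where r: "r \<le> k" and p: "\<And>i. i < r \<Longrightarrow> p i \<in> X" and nd: "nondegenerate K p r"
    unfolding P_def by auto
  have degenerate: "\<exists>c. (\<exists>j<s. c j \<noteq> 0) \<and> (\<forall>i<s. (\<Sum>j<s. K (q i) (q j) * c j) = 0)"
    if "r < s" "s \<le> r + 2" "\<And>i. i < s \<Longrightarrow> q i \<in> X" for s q
  proof -
    have "\<not> nondegenerate K q s"
      using max[of s] bound[of s q] that r unfolding P_def by auto
    thus ?thesis unfolding nondegenerate_def by blast
  qed
  \<comment> \<open>One additional point: a null vector gives the coordinates \<open>d x\<close> of \<open>x\<close> with respect to \<open>p\<close>.\<close>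
  have "\<exists>d. (\<forall>i<r. K (p i) x = (\<Sum>j<r. K (p i) (p j) * d j)) \<and> K x x = (\<Sum>j<r. K x (p j) * d j)"
    if x: "x \<in> X" for x
  proof -
    define q where "q = p(r := x)"
    have "q i \<in> X" if "i < Suc r" for i using that p x by (auto simp: q_def less_Suc_eq)
    from degenerate[of "Suc r" q, OF _ _ this] obtain c where
      c: "\<exists>j<Suc r. c j \<noteq> 0" "\<And>i. i < Suc r \<Longrightarrow> (\<Sum>j<Suc r. K (q i) (q j) * c j) = 0" by auto
    have row: "(\<Sum>j<r. K (p i) (p j) * c j) + K (p i) x * c r = 0" if "i < r" for i
      using c(2)[of i] that by (simp add: q_def)
    have rowx: "(\<Sum>j<r. K x (p j) * c j) + K x x * c r = 0"
      using c(2)[of r] by (simp add: q_def)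
    have cr: "c r \<noteq> 0"
    proof
      assume "c r = 0"
      hence "\<forall>j<r. c j = 0" using row nd unfolding nondegenerate_def by auto
      with c(1) \<open>c r = 0\<close> show False by (auto simp: less_Suc_eq)
    qed
    show ?thesis
      by (rule exI[of _ "\<lambda>j. - c j / c r"])
        (use row rowx cr in \<open>auto simp: sum_negf sum_divide_distrib[symmetric] field_simps eq_neg_iff_add_eq_0\<close>)
  qed
  then obtain d where
    d: "\<And>x i. x \<in> X \<Longrightarrow> i < r \<Longrightarrow> K (p i) x = (\<Sum>j<r. K (p i) (p j) * d x j)"
      "\<And>x. x \<in> X \<Longrightarrow> K x x = (\<Sum>j<r. K x (p j) * d x j)"
    by metis
  have "K x y = (\<Sum>i<r. \<Sum>j<r. d x i * K (p i) (p j) * d y j)" if x: "x \<in> X" and y: "y \<in> X" for x y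
  proof -
    have Kx: "(\<Sum>j<r. K x (p j) * d y j) = (\<Sum>i<r. \<Sum>j<r. d x i * K (p i) (p j) * d y j)"
      if x: "x \<in> X" and y: "y \<in> X" for x y
    proof -
      have "(\<Sum>j<r. K x (p j) * d y j) = (\<Sum>j<r. \<Sum>i<r. d x i * K (p i) (p j) * d y j)"
      proof (rule sum.cong[OF refl])
        fix j assume "j \<in> {..<r}"
        hence "K x (p j) = (\<Sum>i<r. K (p j) (p i) * d x i)"
          using d(1)[OF x, of j] sym[OF x p[of j]] by simp
        also have "\<dots> = (\<Sum>i<r. K (p i) (p j) * d x i)"
          using \<open>j \<in> {..<r}\<close> by (intro sum.cong refl) (simp add: sym[OF p p])
        finally show "K x (p j) * d y j = (\<Sum>i<r. d x i * K (p i) (p j) * d y j)"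
          by (simp add: sum_distrib_left sum_distrib_right mult_ac)
      qed
      also have "\<dots> = (\<Sum>i<r. \<Sum>j<r. d x i * K (p i) (p j) * d y j)" by (rule sum.swap)
      finally show ?thesis .
    qed
    have symd: "(\<Sum>j<r. K y (p j) * d x j) = (\<Sum>j<r. K x (p j) * d y j)"
    proof -
      have "(\<Sum>j<r. K y (p j) * d x j) = (\<Sum>i<r. \<Sum>j<r. d y i * K (p i) (p j) * d x j)"
        by (rule Kx[OF y x])
      also have "\<dots> = (\<Sum>j<r. \<Sum>i<r. d y i * K (p i) (p j) * d x j)" by (rule sum.swap)
      also have "\<dots> = (\<Sum>j<r. \<Sum>i<r. d x j * K (p j) (p i) * d y i)"
        by (intro sum.cong refl) (simp add: sym[OF p p])
      also have "\<dots> = (\<Sum>j<r. K x (p j) * d y j)" by (rule Kx[OF x y, symmetric])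
      finally show ?thesis .
    qed
    \<comment> \<open>Two additional points: the equations of a null vector leave a multiple of the Schur
      complement at \<open>(x, y)\<close>.\<close>
    define q where "q = p(r := x, Suc r := y)"
    have "q i \<in> X" if "i < Suc (Suc r)" for i using that p x y by (auto simp: q_def less_Suc_eq)
    from degenerate[of "Suc (Suc r)" q, OF _ _ this] obtain c where
      c: "\<exists>j<Suc (Suc r). c j \<noteq> 0"
        "\<And>i. i < Suc (Suc r) \<Longrightarrow> (\<Sum>j<Suc (Suc r). K (q i) (q j) * c j) = 0" by auto
    define a where "a = c r"
    define b where "b = c (Suc r)"
    have row: "(\<Sum>j<r. K (p i) (p j) * c j) + K (p i) x * a + K (p i) y * b = 0" if "i < r" for i
      using c(2)[of i] that by (simp add: q_def a_def b_def)
    have rowx: "(\<Sum>j<r. K x (p j) * c j) + K x x * a + K x y * b = 0"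
      using c(2)[of r] by (simp add: q_def a_def b_def)
    have rowy: "(\<Sum>j<r. K y (p j) * c j) + K y x * a + K y y * b = 0"
      using c(2)[of "Suc r"] by (simp add: q_def a_def b_def)
    have "(\<Sum>j<r. K (p i) (p j) * (c j + d x j * a + d y j * b)) = 0" if "i < r" for i
      using row[OF that] d(1)[OF x that] d(1)[OF y that]
      by (simp add: algebra_simps sum.distrib sum_distrib_left)
    hence cj: "c j = - (d x j * a) - d y j * b" if "j < r" for j
      using nd[unfolded nondegenerate_def, rule_format, of "\<lambda>j. c j + d x j * a + d y j * b" j] that
      by (simp add: algebra_simps)
    have Kc: "(\<Sum>j<r. K z (p j) * c j) = - ((\<Sum>j<r. K z (p j) * d x j) * a) - (\<Sum>j<r. K z (p j) * d y j) * b" for z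
    proof -
      have "(\<Sum>j<r. K z (p j) * c j) = (\<Sum>j<r. - (K z (p j) * d x j * a) - K z (p j) * d y j * b)"
        by (intro sum.cong refl) (simp add: cj algebra_simps)
      thus ?thesis by (simp add: sum_subtractf sum_negf sum_distrib_right)
    qed
    have "a \<noteq> 0 \<or> b \<noteq> 0"
      using c(1) cj by (auto simp: a_def b_def less_Suc_eq)
    moreover have "b * (K x y - (\<Sum>j<r. K x (p j) * d y j)) = 0"
      using rowx unfolding Kc d(2)[OF x, symmetric] by (simp add: algebra_simps)
    moreover have "a * (K x y - (\<Sum>j<r. K x (p j) * d y j)) = 0"
      using rowy unfolding Kc d(2)[OF y, symmetric] symd sym[OF x y] by (simp add: algebra_simps)
    ultimately have "K x y = (\<Sum>j<r. K x (p j) * d y j)" by auto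
    thus ?thesis using Kx[OF x y] by simp
  qed
  with r p show ?thesis
    by (intro exI[of _ r] exI[of _ p] exI[of _ d] conjI allI impI ballI) assumption+
qed

text \<open>
  Cholesky factorization, by splitting off the last row and column. If the pivot \<open>a\<close> is \<open>0\<close>, then
  positivity makes the whole last row zero, and the formulas below, where a division by \<open>a\<close> then
  yields \<open>0\<close>, remain correct.
\<close>

lemma psd_matrix_is_gram:
  fixes M :: "nat \<Rightarrow> nat \<Rightarrow> real"
  assumes "\<And>i j. i < r \<Longrightarrow> j < r \<Longrightarrow> M i j = M j i"
    and "\<And>v. 0 \<le> (\<Sum>i<r. \<Sum>j<r. v i * M i j * v j)"
  shows "\<exists>L. \<forall>i<r. \<forall>j<r. M i j = (\<Sum>m<r. L i m * L j m)"
  using assms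
proof (induction r arbitrary: M)
  case 0
  thus ?case by simp
next
  case (Suc r)
  note sym = Suc.prems(1) and psd = Suc.prems(2)
  define a where "a = M r r"
  have split: "0 \<le> (\<Sum>i<r. \<Sum>j<r. w i * M i j * w j) + 2 * t * (\<Sum>j<r. M r j * w j) + t^2 * a" for w t
  proof -
    have "(\<Sum>j<r. w j * M j r * t) = t * (\<Sum>j<r. M r j * w j)"
      unfolding sum_distrib_left by (intro sum.cong refl) (use sym in \<open>auto simp: mult_ac\<close>)
    hence "(\<Sum>i<Suc r. \<Sum>j<Suc r. (w(r := t)) i * M i j * (w(r := t)) j) =
      (\<Sum>i<r. \<Sum>j<r. w i * M i j * w j) + 2 * t * (\<Sum>j<r. M r j * w j) + t^2 * a"
      by (simp add: sum.distrib a_def power2_eq_square sum_distrib_left mult_ac)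
    thus ?thesis using psd[of "w(r := t)"] by simp
  qed
  have a0: "0 \<le> a" using split[of "\<lambda>_. 0" 1] by simp
  \<comment> \<open>Otherwise the form, linear in \<open>t\<close> on \<open>e + t b\<close> for the basis vectors \<open>e\<close>, \<open>b\<close> of index \<open>i\<close> and \<open>r\<close>,
    would take negative values.\<close>
  have row0: "M r i = 0" if "a = 0" "i < r" for i
  proof (rule ccontr)
    assume nz: "M r i \<noteq> 0"
    define e :: "nat \<Rightarrow> real" where "e j = (if j = i then 1 else 0)" for j
    have e: "(\<Sum>j<r. f j * e j) = f i" for f :: "nat \<Rightarrow> real"
      using that by (simp add: e_def if_distrib cong: if_cong)
    have e': "(\<Sum>j<r. e j * f j) = f i" for f :: "nat \<Rightarrow> real"
      using e[of f] by (simp add: mult.commute)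
    have "0 \<le> M i i + 2 * t * M r i" for t
      using split[of e t] that(1) by (simp add: e e')
    from this[of "- (M i i + 1) / (2 * M r i)"] show False using nz by (simp add: field_simps)
  qed
  define M' where "M' i j = M i j - M r i * M r j / a" for i j
  have "\<exists>L. \<forall>i<r. \<forall>j<r. M' i j = (\<Sum>m<r. L i m * L j m)"
  proof (rule Suc.IH)
    show "M' i j = M' j i" if "i < r" "j < r" for i j
      using sym[of i j] that by (simp add: M'_def)
    fix v :: "nat \<Rightarrow> real"
    let ?S = "\<Sum>j<r. M r j * v j"
    have "(\<Sum>i<r. \<Sum>j<r. v i * M' i j * v j) =
        (\<Sum>i<r. \<Sum>j<r. v i * M i j * v j) - (\<Sum>i<r. \<Sum>j<r. (M r i * v i) * (M r j * v j)) / a"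
      by (simp add: M'_def algebra_simps sum_subtractf sum_divide_distrib)
    also have "(\<Sum>i<r. \<Sum>j<r. (M r i * v i) * (M r j * v j)) = ?S^2"
      by (simp add: power2_eq_square sum_product)
    finally show "0 \<le> (\<Sum>i<r. \<Sum>j<r. v i * M' i j * v j)"
      using split[of v "- ?S / a"] by (cases "a = 0") (auto simp: power2_eq_square)
  qed
  then obtain L where L: "\<And>i j. i < r \<Longrightarrow> j < r \<Longrightarrow> M' i j = (\<Sum>m<r. L i m * L j m)" by blast
  define L' where "L' i m = (if m = r then if i = r then sqrt a else M r i / sqrt a
      else if i = r then 0 else L i m)" for i m
  have *: "(\<Sum>m<Suc r. L' i m * L' j m) = (\<Sum>m<r. L' i m * L' j m) + L' i r * L' j r" for i j by simp
  have "M i j = (\<Sum>m<Suc r. L' i m * L' j m)" if ij: "i < Suc r" "j < Suc r" for i j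
  proof -
    have lt: "(\<Sum>m<r. L' i m * L' j m) = (if i = r \<or> j = r then 0 else M' i j)"
      using ij L[of i j] by (auto simp: L'_def)
    show ?thesis
      unfolding * lt using ij a0 row0 sym[of r i] sym[of r j]
      by (cases "a = 0") (auto simp: L'_def M'_def a_def less_Suc_eq)
  qed
  thus ?case by blast
qed

text \<open>
  A null vector of the right factor is a null vector of the Gram matrix, so a kernel that factors
  through \<open>k\<close> functions has no nondegenerate tuple of more than \<open>k\<close> points.
\<close>

lemma nondegenerate_factor_bound:
  assumes "nondegenerate K p r"
    and fac: "\<And>i j. i < r \<Longrightarrow> j < r \<Longrightarrow> K (p i) (p j) = (\<Sum>m<k. B i m * C m j)"
  shows "r \<le> k"
proof (rule ccontr)
  assume "\<not> r \<le> k"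
  then obtain c where c: "\<exists>j<r. c j \<noteq> 0" "\<And>m. m < k \<Longrightarrow> (\<Sum>j<r. C m j * c j) = 0"
    using underdetermined_system_has_nonzero_solution[of k r C] by auto
  have "(\<Sum>j<r. K (p i) (p j) * c j) = 0" if "i < r" for i
  proof -
    have "(\<Sum>j<r. K (p i) (p j) * c j) = (\<Sum>j<r. \<Sum>m<k. B i m * (C m j * c j))"
      using that by (intro sum.cong refl) (simp add: fac sum_distrib_left mult_ac)
    also have "\<dots> = (\<Sum>m<k. \<Sum>j<r. B i m * (C m j * c j))" by (rule sum.swap)
    also have "\<dots> = 0" by (simp add: sum_distrib_left[symmetric] c(2))
    finally show ?thesis .
  qed
  thus False using assms(1) c(1) unfolding nondegenerate_def by blast
qed

section \<open>Positive semidefinite matrices as Gram matrices\<close>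

abbreviation dot :: "nat \<Rightarrow> (nat \<Rightarrow> real) \<Rightarrow> (nat \<Rightarrow> real) \<Rightarrow> real" where
  "dot l x y \<equiv> \<Sum>j<l. x j * y j"

lemma quadratic_form_eq_sum:
  fixes A :: "real mat"
  assumes "A \<in> carrier_mat n n" "v \<in> carrier_vec n"
  shows "scalar_prod v (A *\<^sub>v v) = (\<Sum>i<n. \<Sum>j<n. vec_index v i * A $$ (i, j) * vec_index v j)"
  using assms by (simp add: scalar_prod_def atLeast0LessThan sum_distrib_left mult_ac)

lemma psd_mats_iff:
  "A \<in> psd_mats n J \<longleftrightarrow> A \<in> symmetric_mats n J \<and>
    (\<forall>v. 0 \<le> (\<Sum>i<n. \<Sum>j<n. v i * A $$ (i, j) * v j))"
proof -
  have "(\<forall>v \<in> carrier_vec n. 0 \<le> scalar_prod v (A *\<^sub>v v)) \<longleftrightarrow>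
      (\<forall>v. 0 \<le> (\<Sum>i<n. \<Sum>j<n. v i * A $$ (i, j) * v j))" if A: "A \<in> carrier_mat n n"
  proof
    assume *: "\<forall>v \<in> carrier_vec n. 0 \<le> scalar_prod v (A *\<^sub>v v)"
    show "\<forall>v. 0 \<le> (\<Sum>i<n. \<Sum>j<n. v i * A $$ (i, j) * v j)"
    proof
      fix v :: "nat \<Rightarrow> real"
      show "0 \<le> (\<Sum>i<n. \<Sum>j<n. v i * A $$ (i, j) * v j)"
        using *[rule_format, of "Matrix.vec n v"] by (simp add: quadratic_form_eq_sum[OF A])
    qed
  next
    assume "\<forall>v. 0 \<le> (\<Sum>i<n. \<Sum>j<n. v i * A $$ (i, j) * v j)"
    thus "\<forall>v \<in> carrier_vec n. 0 \<le> scalar_prod v (A *\<^sub>v v)"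
      by (simp add: quadratic_form_eq_sum[OF A])
  qed
  thus ?thesis unfolding psd_mats_def symmetric_mats_def by blast
qed

lemma symmetric_matI:
  assumes "\<And>i j. i < n \<Longrightarrow> j < n \<Longrightarrow> F i j = F j i" "\<And>i j. i < n \<Longrightarrow> j < n \<Longrightarrow> F i j \<in> J"
  shows "mat n n (\<lambda>(i, j). F i j) \<in> symmetric_mats n J"
  using assms unfolding symmetric_mats_def elements_mat_def by (auto intro!: eq_matI)

lemma symmetric_matsD:
  assumes "A \<in> symmetric_mats n J"
  shows "A \<in> carrier_mat n n" "\<And>i j. i < n \<Longrightarrow> j < n \<Longrightarrow> A $$ (i, j) = A $$ (j, i)"
    "\<And>i j. i < n \<Longrightarrow> j < n \<Longrightarrow> A $$ (i, j) \<in> J"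
proof -
  show A: "A \<in> carrier_mat n n" using assms by (simp add: symmetric_mats_def)
  show "A $$ (i, j) = A $$ (j, i)" if "i < n" "j < n" for i j
  proof -
    have "A $$ (i, j) = transpose_mat A $$ (i, j)" using assms by (simp add: symmetric_mats_def)
    thus ?thesis using that A by simp
  qed
  show "A $$ (i, j) \<in> J" if "i < n" "j < n" for i j
    using elements_matI[OF A that refl] assms by (auto simp: symmetric_mats_def)
qed

text \<open>
  Rows and columns may be repeated: the form in \<open>v\<close> is the original form at the vector whose entry
  at \<open>x\<close> is the sum of the \<open>v i\<close> with \<open>p i = x\<close>.
\<close>

lemma psd_quadratic_form_on_tuple:
  fixes K :: "nat \<Rightarrow> nat \<Rightarrow> real"
  assumes psd: "\<And>v. 0 \<le> (\<Sum>i<n. \<Sum>j<n. v i * K i j * v j)" and p: "\<And>i. i < r \<Longrightarrow> p i < n"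
  shows "0 \<le> (\<Sum>i<r. \<Sum>j<r. v i * K (p i) (p j) * v j)"
proof -
  define V where "V x = (\<Sum>i<r. if p i = x then v i else 0)" for x
  have V: "(\<Sum>x<n. V x * g x) = (\<Sum>i<r. v i * g (p i))" for g
  proof -
    have "(\<Sum>x<n. V x * g x) = (\<Sum>x<n. \<Sum>i<r. if p i = x then v i * g (p i) else 0)"
      unfolding V_def sum_distrib_right by (intro sum.cong refl) auto
    also have "\<dots> = (\<Sum>i<r. \<Sum>x<n. if p i = x then v i * g (p i) else 0)" by (rule sum.swap)
    also have "\<dots> = (\<Sum>i<r. v i * g (p i))" using p by (intro sum.cong refl) simp
    finally show ?thesis .
  qed
  have "(\<Sum>x<n. \<Sum>y<n. V x * K x y * V y) = (\<Sum>x<n. V x * (\<Sum>y<n. V y * K x y))"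
    by (simp add: sum_distrib_left mult_ac)
  also have "\<dots> = (\<Sum>i<r. \<Sum>j<r. v i * K (p i) (p j) * v j)"
    unfolding V by (simp add: sum_distrib_left mult_ac)
  finally show ?thesis using psd[of V] by simp
qed

text \<open>
  The kernel decomposition reduces the matrix to a nonsingular principal submatrix, whose size is at
  most the rank; a Cholesky factor of that submatrix then has at most \<open>l\<close> columns, so that the Gram
  vectors can be taken in dimension \<open>l\<close> rather than \<open>n\<close>.
\<close>

lemma psd_mat_rank_le_is_gram:
  assumes "A \<in> psd_mats_rank_le n l J"
  shows "\<exists>u. \<forall>i<n. \<forall>j<n. A $$ (i, j) = dot l (u i) (u j)"
proof -
  have A: "A \<in> symmetric_mats n J" "\<And>v. 0 \<le> (\<Sum>i<n. \<Sum>j<n. v i * A $$ (i, j) * v j)"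
    and rank: "vec_space.rank n A \<le> l"
    using assms by (auto simp: psd_mats_rank_le_def psd_mats_iff)
  note A' = symmetric_matsD[OF A(1)]
  obtain B C where BC: "\<And>i j. i < n \<Longrightarrow> j < n \<Longrightarrow> A $$ (i, j) = (\<Sum>m<l. B i m * C m j)"
    using factors_if_rank_le[OF A'(1) rank] by blast
  let ?K = "\<lambda>i j. A $$ (i, j)"
  have bound: "r \<le> l" if "\<forall>i<r. p i \<in> {..<n}" "nondegenerate ?K p r" for r p
    using that(1)
    by (intro nondegenerate_factor_bound[OF that(2), where B = "\<lambda>i. B (p i)" and C = "\<lambda>m j. C m (p j)"]) (auto intro: BC)
  have "\<exists>r p d. r \<le> l \<and> (\<forall>i<r. p i \<in> {..<n}) \<and> (\<forall>x\<in>{..<n}. \<forall>y\<in>{..<n}.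
      ?K x y = (\<Sum>i<r. \<Sum>j<r. d x i * ?K (p i) (p j) * d y j))"
    by (rule symmetric_kernel_decomposition) (use A'(2) bound in auto)
  then obtain r p d where r: "r \<le> l" and p': "\<forall>i<r. p i \<in> {..<n}" and
    d': "\<forall>x\<in>{..<n}. \<forall>y\<in>{..<n}. ?K x y = (\<Sum>i<r. \<Sum>j<r. d x i * ?K (p i) (p j) * d y j)"
    by (elim exE conjE) (rule that)
  have p: "p i < n" if "i < r" for i using p' that by simp
  have d: "A $$ (x, y) = (\<Sum>i<r. \<Sum>j<r. d x i * A $$ (p i, p j) * d y j)" if "x < n" "y < n" for x y
    using d' that by simp
  obtain L where L: "\<And>i j. i < r \<Longrightarrow> j < r \<Longrightarrow> A $$ (p i, p j) = (\<Sum>m<r. L i m * L j m)"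
    using psd_matrix_is_gram[of r "\<lambda>i j. A $$ (p i, p j)"] A'(2) p
      psd_quadratic_form_on_tuple[where K = ?K and p = p, OF A(2)] by auto
  define u where "u x m = (if m < r then \<Sum>i<r. d x i * L i m else 0)" for x m
  have "A $$ (x, y) = dot l (u x) (u y)" if "x < n" "y < n" for x y
  proof -
    have "A $$ (x, y) = (\<Sum>i<r. \<Sum>j<r. \<Sum>m<r. (d x i * L i m) * (d y j * L j m))"
      unfolding d[OF that] by (intro sum.cong refl) (simp add: L sum_distrib_left sum_distrib_right mult_ac)
    also have "\<dots> = (\<Sum>i<r. \<Sum>m<r. \<Sum>j<r. (d x i * L i m) * (d y j * L j m))"
      by (intro sum.cong refl sum.swap)
    also have "\<dots> = (\<Sum>m<r. \<Sum>i<r. \<Sum>j<r. (d x i * L i m) * (d y j * L j m))" by (rule sum.swap)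
    also have "\<dots> = (\<Sum>m<r. u x m * u y m)" by (simp add: u_def sum_product)
    also have "\<dots> = dot l (u x) (u y)"
      by (rule sum.mono_neutral_left) (use r in \<open>auto simp: u_def\<close>)
    finally show ?thesis .
  qed
  thus ?thesis by blast
qed

section \<open>Functions with a dilation relation are polynomials\<close>

text \<open>
  Near every point of \<open>U\<close>, the same combination of the values of \<open>f\<close> at dilated copies
  \<open>x + \<delta> T\<close> of a finite pattern \<open>T\<close> vanishes. The condition is local, so translating \<open>T\<close> and
  differentiating the relation stay inside \<open>U\<close>.
\<close>

definition dilation_relation :: "(real \<Rightarrow> real) \<Rightarrow> real set \<Rightarrow> (real \<Rightarrow> real) \<Rightarrow> real set \<Rightarrow> bool" where
  "dilation_relation f T q U \<longleftrightarrow>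
    (\<forall>c\<in>U. \<exists>\<eta>>0. \<forall>x \<delta>. \<bar>x - c\<bar> < \<eta> \<longrightarrow> 0 < \<delta> \<longrightarrow> \<delta> < \<eta> \<longrightarrow>
      (\<Sum>\<tau>\<in>T. q \<tau> * f (x + \<tau> * \<delta>)) = 0)"

lemma dilation_relation_rebase:
  assumes "dilation_relation f T q U"
  shows "dilation_relation f ((\<lambda>\<tau>. \<tau> - \<tau>0) ` T) (\<lambda>\<tau>. q (\<tau> + \<tau>0)) U"
  unfolding dilation_relation_def
proof
  fix c assume "c \<in> U"
  then obtain \<eta> where \<eta>: "\<eta> > 0"
    "\<And>x \<delta>. \<bar>x - c\<bar> < \<eta> \<Longrightarrow> 0 < \<delta> \<Longrightarrow> \<delta> < \<eta> \<Longrightarrow> (\<Sum>\<tau>\<in>T. q \<tau> * f (x + \<tau> * \<delta>)) = 0"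
    using assms unfolding dilation_relation_def by blast
  define \<eta>' where "\<eta>' = \<eta> / (1 + \<bar>\<tau>0\<bar>)"
  have pos: "0 < 1 + \<bar>\<tau>0\<bar>" by linarith
  have "\<eta>' * (1 + \<bar>\<tau>0\<bar>) = \<eta>" using pos by (simp add: \<eta>'_def)
  hence \<eta>': "\<eta>' + \<bar>\<tau>0\<bar> * \<eta>' = \<eta>" by (simp add: algebra_simps)
  have \<eta>'0: "0 < \<eta>'" using \<eta>(1) pos by (simp add: \<eta>'_def)
  have "(\<Sum>\<tau>\<in>(\<lambda>\<tau>. \<tau> - \<tau>0) ` T. q (\<tau> + \<tau>0) * f (x + \<tau> * \<delta>)) = 0"
    if "\<bar>x - c\<bar> < \<eta>'" "0 < \<delta>" "\<delta> < \<eta>'" for x \<delta>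
  proof -
    have "\<bar>\<tau>0 * \<delta>\<bar> \<le> \<bar>\<tau>0\<bar> * \<eta>'" using that by (simp add: abs_mult mult_left_mono)
    hence "\<bar>(x - \<tau>0 * \<delta>) - c\<bar> < \<eta>" using that(1) \<eta>' by linarith
    moreover have "\<delta> < \<eta>" using that \<eta>' by (smt (verit) mult_nonneg_nonneg)
    ultimately have "(\<Sum>\<tau>\<in>T. q \<tau> * f (x - \<tau>0 * \<delta> + \<tau> * \<delta>)) = 0"
      using \<eta>(2) that(2) by blast
    thus ?thesis by (subst sum.reindex) (auto simp: inj_on_def algebra_simps)
  qed
  thus "\<exists>\<eta>>0. \<forall>x \<delta>. \<bar>x - c\<bar> < \<eta> \<longrightarrow> 0 < \<delta> \<longrightarrow> \<delta> < \<eta> \<longrightarrow>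
      (\<Sum>\<tau>\<in>(\<lambda>\<tau>. \<tau> - \<tau>0) ` T. q (\<tau> + \<tau>0) * f (x + \<tau> * \<delta>)) = 0"
    using \<eta>'0 by blast
qed

lemma small_dilations_stay_in_open_set:
  fixes U :: "real set"
  assumes "open U" "finite T" "c \<in> U" "0 < \<eta>"
  shows "\<exists>\<epsilon>>0. \<epsilon> \<le> \<eta> \<and> (\<forall>x \<delta> \<tau>. \<bar>x - c\<bar> < \<epsilon> \<longrightarrow> \<bar>\<delta>\<bar> \<le> \<epsilon> \<longrightarrow> \<tau> \<in> T \<longrightarrow> x + \<tau> * \<delta> \<in> U)"
proof -
  obtain \<rho> where \<rho>: "\<rho> > 0" "\<And>x. \<bar>x - c\<bar> < \<rho> \<Longrightarrow> x \<in> U"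
    using assms(1,3) unfolding open_real_def dist_real_def by (metis (no_types) assms(1) dist_real_def open_dist)
  define N where "N = 1 + (\<Sum>\<tau>\<in>T. \<bar>\<tau>\<bar>)"
  define \<epsilon> where "\<epsilon> = min \<eta> (\<rho> / (1 + N))"
  have N: "1 \<le> N" by (simp add: N_def sum_nonneg)
  have \<epsilon>: "0 < \<epsilon>" "\<epsilon> \<le> \<eta>" "\<epsilon> + N * \<epsilon> \<le> \<rho>"
  proof -
    show "0 < \<epsilon>" using assms(4) \<rho>(1) N by (simp add: \<epsilon>_def)
    show "\<epsilon> \<le> \<eta>" by (simp add: \<epsilon>_def)
    have "\<epsilon> * (1 + N) \<le> \<rho> / (1 + N) * (1 + N)" using N by (intro mult_right_mono) (auto simp: \<epsilon>_def)
    also have "\<dots> = \<rho>" using N by simp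
    finally show "\<epsilon> + N * \<epsilon> \<le> \<rho>" by (simp add: algebra_simps)
  qed
  have "x + \<tau> * \<delta> \<in> U" if "\<bar>x - c\<bar> < \<epsilon>" "\<bar>\<delta>\<bar> \<le> \<epsilon>" "\<tau> \<in> T" for x \<delta> \<tau>
  proof (rule \<rho>(2))
    have "\<bar>\<tau>\<bar> \<le> N" using member_le_sum[of \<tau> T abs] assms(2) that(3) by (simp add: N_def)
    hence "\<bar>\<tau> * \<delta>\<bar> \<le> N * \<epsilon>" unfolding abs_mult using that N by (intro mult_mono) auto
    thus "\<bar>x + \<tau> * \<delta> - c\<bar> < \<rho>" using that(1) \<epsilon>(3) by linarith
  qed
  thus ?thesis using \<epsilon> by blast
qed

text \<open>
  Integrating the relation over \<open>\<delta>\<close> in \<open>[0, \<epsilon>]\<close> at a fixed \<open>x\<close> expresses \<open>\<epsilon> q 0 f x\<close> through differences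
  of an antiderivative \<open>F\<close> of \<open>f\<close>, and hence \<open>f\<close> is as smooth as \<open>F\<close>: one derivative is gained.
\<close>

lemma dilation_relation_imp_C1:
  assumes U: "open U" and T: "finite T" "0 \<in> T" "q 0 \<noteq> 0"
    and rel: "dilation_relation f T q U" and cont: "continuous_on U f"
  shows "\<exists>g. continuous_on U g \<and> (\<forall>x\<in>U. (f has_real_derivative g x) (at x))"
proof -
  have loc: "\<exists>V h. open V \<and> c \<in> V \<and> isCont h c \<and> (\<forall>x\<in>V. (f has_real_derivative h x) (at x))"
    if c: "c \<in> U" for c
  proof -
    obtain \<rho> where \<rho>: "\<rho> > 0" "cball c \<rho> \<subseteq> U" using U c open_contains_cball by blast
    define W where "W = {c - \<rho> <..< c + \<rho>}"
    have W: "open W" "c \<in> W" "W \<subseteq> U"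
      using \<rho> by (auto simp: W_def subset_iff dist_real_def)
    define F where "F x = integral {c - \<rho>..x} f" for x
    have F: "(F has_real_derivative f x) (at x)" if "x \<in> W" for x
    proof -
      have "{c - \<rho>..c + \<rho>} \<subseteq> U" using \<rho>(2) by (auto simp: subset_iff dist_real_def)
      hence "continuous_on {c - \<rho>..c + \<rho>} f" using cont continuous_on_subset by blast
      hence "(F has_real_derivative f x) (at x within {c - \<rho>..c + \<rho>})"
        unfolding F_def by (rule integral_has_real_derivative) (use that in \<open>auto simp: W_def\<close>)
      hence "(F has_real_derivative f x) (at x within W)"
        by (rule has_field_derivative_subset) (auto simp: W_def)
      thus ?thesis using at_within_open[OF that W(1)] by simp
    qed
    obtain \<eta> where \<eta>: "\<eta> > 0"
      "\<And>x \<delta>. \<bar>x - c\<bar> < \<eta> \<Longrightarrow> 0 < \<delta> \<Longrightarrow> \<delta> < \<eta> \<Longrightarrow> (\<Sum>\<tau>\<in>T. q \<tau> * f (x + \<tau> * \<delta>)) = 0"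
      using rel c unfolding dilation_relation_def by blast
    obtain \<epsilon> where \<epsilon>: "\<epsilon> > 0" "\<epsilon> \<le> \<eta>"
      "\<And>x \<delta> \<tau>. \<bar>x - c\<bar> < \<epsilon> \<Longrightarrow> \<bar>\<delta>\<bar> \<le> \<epsilon> \<Longrightarrow> \<tau> \<in> T \<Longrightarrow> x + \<tau> * \<delta> \<in> W"
      using small_dilations_stay_in_open_set[OF W(1) T(1) W(2) \<eta>(1)] by blast
    define T' where "T' = T - {0}"
    have T': "finite T'" "\<And>\<tau>. \<tau> \<in> T' \<Longrightarrow> \<tau> \<noteq> 0 \<and> \<tau> \<in> T" using T(1) by (auto simp: T'_def)
    define V where "V = {c - \<epsilon> <..< c + \<epsilon>}"
    have V: "open V" "c \<in> V" using \<epsilon>(1) by (auto simp: V_def)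
    have inW: "x + \<tau> * \<delta> \<in> W" if "x \<in> V" "\<bar>\<delta>\<bar> \<le> \<epsilon>" "\<tau> \<in> T" for x \<delta> \<tau>
      by (rule \<epsilon>(3)) (use that in \<open>auto simp: V_def abs_less_iff\<close>)
    define G where "G x = - (\<Sum>\<tau>\<in>T'. q \<tau> / \<tau> * (F (x + \<tau> * \<epsilon>) - F x)) / (\<epsilon> * q 0)" for x
    define h where "h x = - (\<Sum>\<tau>\<in>T'. q \<tau> / \<tau> * (f (x + \<tau> * \<epsilon>) - f x)) / (\<epsilon> * q 0)" for x
    have G: "(G has_real_derivative h x) (at x)" if "x \<in> V" for x
    proof -
      have 0: "(F has_real_derivative f x) (at x)"
        using F inW[OF that, of 0 0] T(2) \<epsilon>(1) by simp
      have "((\<lambda>x. F (x + \<tau> * \<epsilon>)) has_real_derivative f (x + \<tau> * \<epsilon>)) (at x)" if "\<tau> \<in> T'" for \<tau>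
      proof -
        have "(F has_real_derivative f (x + \<tau> * \<epsilon>)) (at (x + \<tau> * \<epsilon>))"
          using F inW[OF \<open>x \<in> V\<close>, of \<epsilon> \<tau>] T' \<epsilon>(1) that by auto
        thus ?thesis by (simp add: DERIV_shift)
      qed
      with 0 show ?thesis unfolding G_def h_def
        by (intro DERIV_cdivide DERIV_minus DERIV_sum DERIV_cmult DERIV_diff) auto
    qed
    have "f x = G x" if "x \<in> V" for x
    proof -
      \<comment> \<open>\<open>H \<delta>\<close> is the integral of the relation over \<open>[0, \<delta>]\<close>, up to a constant.\<close>
      define H where "H \<delta> = \<delta> * (q 0 * f x) + (\<Sum>\<tau>\<in>T'. q \<tau> / \<tau> * F (x + \<tau> * \<delta>))" for \<delta>
      have H: "(H has_real_derivative (q 0 * f x + (\<Sum>\<tau>\<in>T'. q \<tau> / \<tau> * (f (x + \<tau> * \<delta>) * \<tau>)))) (at \<delta>)"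
        if "0 \<le> \<delta>" "\<delta> \<le> \<epsilon>" for \<delta>
      proof -
        have "((\<lambda>\<delta>. F (x + \<tau> * \<delta>)) has_real_derivative f (x + \<tau> * \<delta>) * \<tau>) (at \<delta>)" if "\<tau> \<in> T'" for \<tau>
          by (rule DERIV_chain2[OF F]) (use inW[OF \<open>x \<in> V\<close>, of \<delta> \<tau>] \<open>0 \<le> \<delta>\<close> \<open>\<delta> \<le> \<epsilon>\<close> T' that in
            \<open>auto intro!: derivative_eq_intros\<close>)
        thus ?thesis unfolding H_def by (intro DERIV_add DERIV_sum DERIV_cmult) (auto intro!: derivative_eq_intros)
      qed
      have "H \<epsilon> = H 0"
      proof (rule DERIV_isconst_end[OF \<epsilon>(1)])
        show "continuous_on {0..\<epsilon>} H"
          by (meson H DERIV_isCont atLeastAtMost_iff continuous_at_imp_continuous_on)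
        fix \<delta> assume \<delta>: "0 < \<delta>" "\<delta> < \<epsilon>"
        have "q 0 * f x + (\<Sum>\<tau>\<in>T'. q \<tau> / \<tau> * (f (x + \<tau> * \<delta>) * \<tau>)) = q 0 * f (x + 0 * \<delta>) + (\<Sum>\<tau>\<in>T'. q \<tau> * f (x + \<tau> * \<delta>))"
          using T' by (simp cong: sum.cong)
        also have "\<dots> = (\<Sum>\<tau>\<in>T. q \<tau> * f (x + \<tau> * \<delta>))"
          unfolding T'_def by (rule sum.remove[OF T(1,2), symmetric])
        also have "\<dots> = 0"
          by (rule \<eta>(2)) (use \<open>x \<in> V\<close> \<delta> \<epsilon>(2) in \<open>auto simp: V_def\<close>)
        finally show "(H has_real_derivative 0) (at \<delta>)" using H[of \<delta>] \<delta> by simp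
      qed
      hence "\<epsilon> * q 0 * f x = - (\<Sum>\<tau>\<in>T'. q \<tau> / \<tau> * (F (x + \<tau> * \<epsilon>) - F x))"
        by (simp add: H_def right_diff_distrib sum_subtractf)
      thus ?thesis using T(3) \<epsilon>(1) unfolding G_def by (metis nonzero_mult_div_cancel_left mult_eq_0_iff less_irrefl)
    qed
    hence "(f has_real_derivative h x) (at x)" if "x \<in> V" for x
      using has_field_derivative_transform_within_open[OF G[OF that] V(1) that] by auto
    moreover have "isCont h c"
    proof -
      have fc: "isCont f x" if "x \<in> W" for x
        using cont that W continuous_on_eq_continuous_at[OF U] by blast
      have "isCont (\<lambda>x. f (x + \<tau> * \<epsilon>)) c" if "\<tau> \<in> T'" for \<tau>
        by (rule isCont_o2[where g = f]) (use fc inW[OF V(2), of \<epsilon> \<tau>] T' \<epsilon>(1) that in auto)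
      moreover have "isCont f c" using fc W by blast
      ultimately show ?thesis unfolding h_def using T(3) \<epsilon>(1)
        by (intro continuous_intros) auto
    qed
    ultimately show ?thesis using V by blast
  qed
  have "isCont (deriv f) c \<and> (f has_real_derivative deriv f c) (at c)" if cU: "c \<in> U" for c
  proof -
    obtain V h where V: "open V" "c \<in> V" "isCont h c" "\<And>x. x \<in> V \<Longrightarrow> (f has_real_derivative h x) (at x)"
      using loc[OF cU] by blast
    have "\<forall>\<^sub>F x in nhds c. deriv f x = h x"
      using eventually_nhds_in_open[OF V(1,2)] by eventually_elim (simp add: DERIV_imp_deriv V(4))
    hence "isCont (deriv f) c" using V(3) isCont_cong by blast
    thus ?thesis using V(2,4) DERIV_imp_deriv by metis
  qed
  thus ?thesis by (intro exI[of _ "deriv f"]) (auto intro: continuous_at_imp_continuous_on)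
qed

text \<open>
  Differentiating in \<open>\<delta>\<close> multiplies the coefficient at \<open>\<tau>\<close> by \<open>\<tau>\<close>, which removes the point \<open>0\<close> from the
  pattern.
\<close>

lemma dilation_relation_derivative:
  assumes U: "open U" and T: "finite T" and rel: "dilation_relation f T q U"
    and f': "\<And>x. x \<in> U \<Longrightarrow> (f has_real_derivative g x) (at x)"
  shows "dilation_relation g (T - {0}) (\<lambda>\<tau>. q \<tau> * \<tau>) U"
  unfolding dilation_relation_def
proof
  fix c assume c: "c \<in> U"
  obtain \<eta> where \<eta>: "\<eta> > 0"
    "\<And>x \<delta>. \<bar>x - c\<bar> < \<eta> \<Longrightarrow> 0 < \<delta> \<Longrightarrow> \<delta> < \<eta> \<Longrightarrow> (\<Sum>\<tau>\<in>T. q \<tau> * f (x + \<tau> * \<delta>)) = 0"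
    using rel c unfolding dilation_relation_def by blast
  obtain \<epsilon> where \<epsilon>: "\<epsilon> > 0" "\<epsilon> \<le> \<eta>"
    "\<And>x \<delta> \<tau>. \<bar>x - c\<bar> < \<epsilon> \<Longrightarrow> \<bar>\<delta>\<bar> \<le> \<epsilon> \<Longrightarrow> \<tau> \<in> T \<Longrightarrow> x + \<tau> * \<delta> \<in> U"
    using small_dilations_stay_in_open_set[OF U T c \<eta>(1)] by blast
  have "(\<Sum>\<tau>\<in>T - {0}. q \<tau> * \<tau> * g (x + \<tau> * \<delta>)) = 0" if "\<bar>x - c\<bar> < \<epsilon>" "0 < \<delta>" "\<delta> < \<epsilon>" for x \<delta>
  proof -
    let ?S = "\<lambda>\<delta>. \<Sum>\<tau>\<in>T. q \<tau> * f (x + \<tau> * \<delta>)"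
    have "((\<lambda>\<delta>. f (x + \<tau> * \<delta>)) has_real_derivative g (x + \<tau> * \<delta>) * \<tau>) (at \<delta>)" if "\<tau> \<in> T" for \<tau>
      by (rule DERIV_chain2[OF f']) (use \<epsilon>(3)[OF \<open>\<bar>x - c\<bar> < \<epsilon>\<close> _ that, of \<delta>] \<open>0 < \<delta>\<close> \<open>\<delta> < \<epsilon>\<close> in
        \<open>auto intro!: derivative_eq_intros\<close>)
    hence "(?S has_real_derivative (\<Sum>\<tau>\<in>T. q \<tau> * (g (x + \<tau> * \<delta>) * \<tau>))) (at \<delta>)"
      by (intro DERIV_sum DERIV_cmult) auto
    moreover have "(?S has_real_derivative 0) (at \<delta>)"
    proof (rule has_field_derivative_transform_within_open[where f = "\<lambda>_. 0" and S = "{0<..<\<epsilon>}"])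
      show "0 = ?S d" if "d \<in> {0<..<\<epsilon>}" for d
        using \<eta>(2)[of x d] \<open>\<bar>x - c\<bar> < \<epsilon>\<close> that \<epsilon>(2) by simp
    qed (use that in auto)
    ultimately have "(\<Sum>\<tau>\<in>T. q \<tau> * (g (x + \<tau> * \<delta>) * \<tau>)) = 0" by (rule DERIV_unique)
    moreover have "(\<Sum>\<tau>\<in>T. q \<tau> * (g (x + \<tau> * \<delta>) * \<tau>)) = (\<Sum>\<tau>\<in>T - {0}. q \<tau> * \<tau> * g (x + \<tau> * \<delta>))"
      by (rule sum.mono_neutral_cong_right) (use T in auto)
    ultimately show ?thesis by simp
  qed
  thus "\<exists>\<eta>>0. \<forall>x \<delta>. \<bar>x - c\<bar> < \<eta> \<longrightarrow> 0 < \<delta> \<longrightarrow> \<delta> < \<eta> \<longrightarrow>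
      (\<Sum>\<tau>\<in>T - {0}. q \<tau> * \<tau> * g (x + \<tau> * \<delta>)) = 0"
    using \<epsilon>(1) by blast
qed

lemma pderiv_surj:
  fixes p :: "'a::field_char_0 poly"
  shows "\<exists>P. pderiv P = p"
proof
  show "pderiv (\<Sum>i\<le>degree p. monom (coeff p i / of_nat (Suc i)) (Suc i)) = p"
    by (simp add: higher_pderiv_sum[where n = 1, simplified] pderiv_monom poly_as_sum_of_monoms del: of_nat_Suc)
qed

text \<open>
  Translate the pattern so that it contains \<open>0\<close>; then \<open>f'\<close> satisfies a relation with one point less
  and is a polynomial by induction. A pattern with one point forces \<open>f = 0\<close>.
\<close>

lemma dilation_relation_imp_polynomial:
  assumes U: "open U" "convex U" and cont: "continuous_on U f"
    and T: "finite T" "T \<noteq> {}" "\<And>\<tau>. \<tau> \<in> T \<Longrightarrow> q \<tau> \<noteq> 0"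
    and rel: "dilation_relation f T q U"
  shows "\<exists>p. \<forall>x\<in>U. f x = poly p x"
  using cont T rel
proof (induction "card T" arbitrary: f T q rule: less_induct)
  case less
  obtain \<tau>0 where \<tau>0: "\<tau>0 \<in> T" using less.prems by blast
  define S where "S = (\<lambda>\<tau>. \<tau> - \<tau>0) ` T"
  define s where "s \<tau> = q (\<tau> + \<tau>0)" for \<tau>
  have S: "finite S" "0 \<in> S" "card S = card T" "\<And>\<tau>. \<tau> \<in> S \<Longrightarrow> s \<tau> \<noteq> 0"
    using less.prems \<tau>0 by (auto simp: S_def s_def inj_on_def intro!: card_image)
  have rel: "dilation_relation f S s U"
    unfolding S_def s_def by (rule dilation_relation_rebase) (rule less.prems)
  show ?case
  proof (cases "S = {0}")
    case True
    have "f x = 0" if xU: "x \<in> U" for x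
    proof -
      obtain \<eta> where "\<eta> > 0" "\<And>y \<delta>. \<bar>y - x\<bar> < \<eta> \<Longrightarrow> 0 < \<delta> \<Longrightarrow> \<delta> < \<eta> \<Longrightarrow>
          (\<Sum>\<tau>\<in>S. s \<tau> * f (y + \<tau> * \<delta>)) = 0"
        using rel xU unfolding dilation_relation_def by blast
      from this(2)[of x "\<eta> / 2"] this(1) show "f x = 0" using S(4)[OF S(2)] True by simp
    qed
    thus ?thesis by (intro exI[of _ 0]) auto
  next
    case False
    obtain g where g: "continuous_on U g" "\<And>x. x \<in> U \<Longrightarrow> (f has_real_derivative g x) (at x)"
      using dilation_relation_imp_C1[OF U(1) S(1,2) S(4)[OF S(2)] rel less.prems(1)] by blast
    have "\<exists>p. \<forall>x\<in>U. g x = poly p x"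
    proof (rule less.hyps[of "S - {0}" g "\<lambda>\<tau>. s \<tau> * \<tau>"])
      show "card (S - {0}) < card T" using S by (metis card_Diff1_less)
      show "dilation_relation g (S - {0}) (\<lambda>\<tau>. s \<tau> * \<tau>) U"
        by (rule dilation_relation_derivative[OF U(1) S(1) rel g(2)])
    qed (use S False g in auto)
    then obtain p where p: "\<And>x. x \<in> U \<Longrightarrow> g x = poly p x" by blast
    obtain P where P: "pderiv P = p" using pderiv_surj by blast
    have "((\<lambda>x. f x - poly P x) has_real_derivative 0) (at x within U)" if "x \<in> U" for x
      using DERIV_diff[OF g(2)[OF that] poly_DERIV[of P x]] p[OF that] P
      by (simp add: has_field_derivative_at_within)
    hence "\<exists>c. \<forall>x\<in>U. f x - poly P x = c"
      by (rule has_field_derivative_zero_constant[OF U(2)])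
    then obtain c where "\<forall>x\<in>U. f x - poly P x = c" by blast
    thus ?thesis by (intro exI[of _ "P + [:c:]"]) (auto simp: algebra_simps)
  qed
qed

text \<open>
  A monotone function has countably many discontinuities, so \<open>\<delta>\<close> can be chosen such that \<open>f\<close> is
  continuous at all the points \<open>c + \<tau> \<delta>\<close> with \<open>\<tau> \<noteq> 0\<close>. For this fixed \<open>\<delta>\<close> the relation writes \<open>f\<close> near \<open>c\<close>
  as a combination of functions that are continuous at \<open>c\<close>.
\<close>

lemma mono_dilation_relation_imp_continuous:
  fixes f :: "real \<Rightarrow> real"
  assumes U: "open U" and mono: "mono_on U f"
    and T: "finite T" "T \<noteq> {}" "\<And>\<tau>. \<tau> \<in> T \<Longrightarrow> q \<tau> \<noteq> 0"
    and rel: "dilation_relation f T q U"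
  shows "continuous_on U f"
proof (rule continuous_at_imp_continuous_on, rule)
  fix c assume c: "c \<in> U"
  obtain \<tau>0 where \<tau>0: "\<tau>0 \<in> T" using T by blast
  define S where "S = (\<lambda>\<tau>. \<tau> - \<tau>0) ` T"
  define s where "s \<tau> = q (\<tau> + \<tau>0)" for \<tau>
  have S: "finite S" "0 \<in> S" "s 0 \<noteq> 0" using T \<tau>0 by (auto simp: S_def s_def)
  have rel: "dilation_relation f S s U"
    unfolding S_def s_def by (rule dilation_relation_rebase) (rule rel)
  obtain \<eta> where \<eta>: "\<eta> > 0"
    "\<And>x \<delta>. \<bar>x - c\<bar> < \<eta> \<Longrightarrow> 0 < \<delta> \<Longrightarrow> \<delta> < \<eta> \<Longrightarrow> (\<Sum>\<tau>\<in>S. s \<tau> * f (x + \<tau> * \<delta>)) = 0"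
    using rel c unfolding dilation_relation_def by blast
  obtain \<epsilon> where \<epsilon>: "\<epsilon> > 0" "\<epsilon> \<le> \<eta>"
    "\<And>x \<delta> \<tau>. \<bar>x - c\<bar> < \<epsilon> \<Longrightarrow> \<bar>\<delta>\<bar> \<le> \<epsilon> \<Longrightarrow> \<tau> \<in> S \<Longrightarrow> x + \<tau> * \<delta> \<in> U"
    using small_dilations_stay_in_open_set[OF U S(1) c \<eta>(1)] by blast
  define D where "D = {a\<in>U. \<not> isCont f a}"
  have "countable D" unfolding D_def by (rule mono_on_ctble_discont_open[OF U mono])
  hence "countable (\<Union>\<tau>\<in>S - {0}. (\<lambda>d. (d - c) / \<tau>) ` D)"
    using S(1) by (intro countable_UN countable_image) (auto intro: countable_finite)
  moreover have "uncountable {0<..<\<epsilon>}" using \<epsilon>(1) by (simp add: uncountable_open_interval)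
  ultimately have "\<not> {0<..<\<epsilon>} \<subseteq> (\<Union>\<tau>\<in>S - {0}. (\<lambda>d. (d - c) / \<tau>) ` D)"
    using countable_subset by blast
  then obtain \<delta> where "\<delta> \<in> {0<..<\<epsilon>}" and \<delta>: "\<delta> \<notin> (\<Union>\<tau>\<in>S - {0}. (\<lambda>d. (d - c) / \<tau>) ` D)" by blast
  hence \<delta>: "0 < \<delta>" "\<delta> < \<epsilon>" "\<delta> \<notin> (\<Union>\<tau>\<in>S - {0}. (\<lambda>d. (d - c) / \<tau>) ` D)" by simp_all
  have shifted: "isCont f (c + \<tau> * \<delta>)" if "\<tau> \<in> S - {0}" for \<tau>
  proof (rule ccontr)
    assume "\<not> isCont f (c + \<tau> * \<delta>)"
    hence "c + \<tau> * \<delta> \<in> D" using \<epsilon>(3)[of c \<delta> \<tau>] \<epsilon>(1) \<delta> that by (auto simp: D_def)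
    hence "(c + \<tau> * \<delta> - c) / \<tau> \<in> (\<Union>\<tau>\<in>S - {0}. (\<lambda>d. (d - c) / \<tau>) ` D)" using that by blast
    thus False using \<delta>(3) that by simp
  qed
  have "isCont (\<lambda>x. f (x + \<tau> * \<delta>)) c" if "\<tau> \<in> S - {0}" for \<tau>
    by (rule isCont_o2[where g = f]) (use shifted that in auto)
  hence "isCont (\<lambda>x. - (\<Sum>\<tau>\<in>S - {0}. s \<tau> * f (x + \<tau> * \<delta>)) / s 0) c"
    using S(3) by (intro continuous_intros) auto
  moreover have "\<forall>\<^sub>F x in nhds c. f x = - (\<Sum>\<tau>\<in>S - {0}. s \<tau> * f (x + \<tau> * \<delta>)) / s 0"
  proof -
    have "f x = - (\<Sum>\<tau>\<in>S - {0}. s \<tau> * f (x + \<tau> * \<delta>)) / s 0" if "x \<in> {c - \<eta><..<c + \<eta>}" for x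
    proof -
      have "(\<Sum>\<tau>\<in>S. s \<tau> * f (x + \<tau> * \<delta>)) = 0"
        by (rule \<eta>(2)) (use that \<delta> \<epsilon>(2) in auto)
      thus ?thesis using S(3) unfolding sum.remove[OF S(1,2)] by (simp add: field_simps)
    qed
    moreover have "\<forall>\<^sub>F x in nhds c. x \<in> {c - \<eta><..<c + \<eta>}"
      using \<eta>(1) by (intro eventually_nhds_in_open) auto
    ultimately show ?thesis by (auto elim: eventually_mono)
  qed
  ultimately show "isCont f c" by (simp add: isCont_cong)
qed

section \<open>Monomials, powers of inner products, and coefficient functionals\<close>

definition multi_indices :: "nat \<Rightarrow> nat \<Rightarrow> nat list set" where
  "multi_indices l i = {\<alpha>. length \<alpha> = l \<and> sum_list \<alpha> = i}"

fun monomial :: "nat list \<Rightarrow> (nat \<Rightarrow> real) \<Rightarrow> real" where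
  "monomial [] x = 1"
| "monomial (b # \<alpha>) x = x 0 ^ b * monomial \<alpha> (\<lambda>j. x (Suc j))"

fun multinomial_coeff :: "nat list \<Rightarrow> real" where
  "multinomial_coeff [] = 1"
| "multinomial_coeff (b # \<alpha>) = real ((b + sum_list \<alpha>) choose b) * multinomial_coeff \<alpha>"

lemma multinomial_coeff_pos: "0 < multinomial_coeff \<alpha>"
  by (induction \<alpha>) auto

lemma multi_indices_0: "multi_indices 0 i = (if i = 0 then {[]} else {})"
  by (auto simp: multi_indices_def)

lemma multi_indices_Suc:
  "multi_indices (Suc l) i = (\<lambda>(b, \<alpha>). b # \<alpha>) ` (SIGMA b:{..i}. multi_indices l (i - b))"
  by (force simp: multi_indices_def length_Suc_conv image_iff)

lemma finite_multi_indices: "finite (multi_indices l i)"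
  by (induction l arbitrary: i) (auto simp: multi_indices_0 multi_indices_Suc)

lemma multi_indices_disjoint: "i \<noteq> j \<Longrightarrow> multi_indices l i \<inter> multi_indices l j = {}"
  by (auto simp: multi_indices_def)

lemma card_multi_indices:
  assumes "1 \<le> l"
  shows "card (multi_indices l i) = (i + l - 1) choose (l - 1)"
proof -
  have "card (multi_indices l i) = (i + l - 1) choose i"
    unfolding multi_indices_def by (rule card_length_sum_list)
  thus ?thesis using assms binomial_symmetric[of i "i + l - 1"] by simp
qed

text \<open>
  The multinomial theorem in the form that exhibits \<open>\<langle>x, y\<rangle> ^ i\<close> as a positive combination of
  \<open>(i + l - 1) choose (l - 1)\<close> products of a function of \<open>x\<close> with the same function of \<open>y\<close>.
\<close>

lemma inner_power_expansion:
  "(\<Sum>j<l. x j * y j) ^ i =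
    (\<Sum>\<alpha>\<in>multi_indices l i. multinomial_coeff \<alpha> * (monomial \<alpha> x * monomial \<alpha> y))"
proof (induction l arbitrary: i x y)
  case 0
  thus ?case by (simp add: multi_indices_0)
next
  case (Suc l)
  have "(\<Sum>j<Suc l. x j * y j) ^ i = (x 0 * y 0 + (\<Sum>j<l. x (Suc j) * y (Suc j))) ^ i"
    by (simp only: sum.lessThan_Suc_shift)
  also have "\<dots> = (\<Sum>b\<le>i. real (i choose b) * (x 0 * y 0) ^ b * (\<Sum>j<l. x (Suc j) * y (Suc j)) ^ (i - b))"
    by (rule binomial_ring)
  also have "\<dots> = (\<Sum>b\<le>i. \<Sum>\<alpha>\<in>multi_indices l (i - b).
      multinomial_coeff (b # \<alpha>) * (monomial (b # \<alpha>) x * monomial (b # \<alpha>) y))"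
    unfolding Suc.IH sum_distrib_left
    by (intro sum.cong refl) (auto simp: multi_indices_def power_mult_distrib mult_ac)
  also have "\<dots> = (\<Sum>(b, \<alpha>)\<in>(SIGMA b:{..i}. multi_indices l (i - b)).
      multinomial_coeff (b # \<alpha>) * (monomial (b # \<alpha>) x * monomial (b # \<alpha>) y))"
    by (rule sum.Sigma) (auto simp: finite_multi_indices)
  also have "\<dots> = (\<Sum>\<alpha>\<in>multi_indices (Suc l) i. multinomial_coeff \<alpha> * (monomial \<alpha> x * monomial \<alpha> y))"
    unfolding multi_indices_Suc
    by (subst sum.reindex) (auto simp: inj_on_def case_prod_unfold)
  finally show ?case .
qed

text \<open>
  Restricting to the curve \<open>t \<mapsto> (t, t ^ M, t ^ M\<^sup>2, \<dots>)\<close> turns the monomial with multi-index \<open>\<alpha>\<close> into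
  \<open>t ^ digits_value M \<alpha>\<close>. The exponents of distinct monomials of degree less than \<open>M\<close> stay distinct, by
  uniqueness of expansions in base \<open>M\<close>, so independence of monomials in several variables reduces
  to one variable.
\<close>

fun digits_value :: "nat \<Rightarrow> nat list \<Rightarrow> nat" where
  "digits_value M [] = 0"
| "digits_value M (b # \<alpha>) = b + M * digits_value M \<alpha>"

lemma digits_value_inj:
  assumes "length \<alpha> = length \<beta>" "\<forall>b\<in>set \<alpha>. b < M" "\<forall>b\<in>set \<beta>. b < M"
    "digits_value M \<alpha> = digits_value M \<beta>"
  shows "\<alpha> = \<beta>"
  using assms
proof (induction \<alpha> \<beta> rule: list_induct2)
  case (Cons a \<alpha> b \<beta>)
  hence eq: "a + M * digits_value M \<alpha> = b + M * digits_value M \<beta>" and lt: "a < M" "b < M" by auto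
  have "a = b" using arg_cong[OF eq, of "\<lambda>z. z mod M"] lt by simp
  moreover have "digits_value M \<alpha> = digits_value M \<beta>" using eq \<open>a = b\<close> lt by simp
  ultimately show ?case using Cons by simp
qed simp

lemma monomial_on_digit_curve: "monomial \<alpha> (\<lambda>j. t ^ (M ^ j)) = t ^ digits_value M \<alpha>"
proof (induction \<alpha> arbitrary: t)
  case (Cons b \<alpha>)
  have "monomial \<alpha> (\<lambda>j. t ^ (M ^ Suc j)) = monomial \<alpha> (\<lambda>j. (t ^ M) ^ (M ^ j))"
    by (simp add: power_mult)
  also have "\<dots> = (t ^ M) ^ digits_value M \<alpha>" by (rule Cons.IH)
  finally show ?case by (simp add: power_add power_mult)
qed simp

text \<open>
  The Vandermonde matrix of distinct points is invertible, and the rows of its inverse recover each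
  coefficient of a polynomial of degree less than \<open>D\<close> as a linear combination of its values.
\<close>

lemma coefficient_functionals:
  fixes t :: "nat \<Rightarrow> real"
  assumes "inj_on t {..<D}"
  shows "\<exists>w. \<forall>e<D. \<forall>e'<D. (\<Sum>j<D. w e j * t j ^ e') = (if e = e' then 1 else 0)"
proof -
  define V where "V = mat D D (\<lambda>(j, e). t j ^ e)"
  have V: "V \<in> carrier_mat D D" by (simp add: V_def)
  have "Determinant.det V \<noteq> 0"
  proof
    assume "Determinant.det V = 0"
    then obtain v where v: "v \<in> carrier_vec D" "v \<noteq> 0\<^sub>v D" "V *\<^sub>v v = 0\<^sub>v D"
      using det_0_iff_vec_prod_zero_field[OF V] by blast
    define p where "p = (\<Sum>e<D. monom (vec_index v e) e)"
    have coeff_p: "coeff p e = (if e < D then vec_index v e else 0)" for e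
      by (simp add: p_def coeff_sum if_distrib cong: if_cong)
    have "poly p (t j) = 0" if "j < D" for j
    proof -
      have "vec_index (V *\<^sub>v v) j = 0" using v(3) that by simp
      thus ?thesis using that v(1)
        by (simp add: V_def scalar_prod_def p_def poly_sum poly_monom atLeast0LessThan mult.commute)
    qed
    hence sub: "t ` {..<D} \<subseteq> {x. poly p x = 0}" by auto
    obtain e where e: "e < D" "vec_index v e \<noteq> 0"
    proof (rule ccontr)
      assume "\<not> thesis"
      hence "v = 0\<^sub>v D" using v(1) that by (intro eq_vecI) auto
      thus False using v(2) by simp
    qed
    hence p0: "p \<noteq> 0" using coeff_p[of e] by auto
    have "D \<le> card {x. poly p x = 0}"
      using card_mono[OF poly_roots_finite[OF p0] sub] card_image[OF assms] by simp
    also have "\<dots> \<le> degree p" by (rule card_poly_roots_bound[OF p0])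
    also have "\<dots> < D" using degree_lessI[of p D] p0 coeff_p by auto
    finally show False by simp
  qed
  from det_non_zero_imp_unit[OF V this, of "()"] obtain W where
    W: "W \<in> carrier_mat D D" "W * V = 1\<^sub>m D"
    unfolding Units_def ring_mat_def by auto
  have "(\<Sum>j<D. W $$ (e, j) * t j ^ e') = (if e = e' then 1 else 0)" if "e < D" "e' < D" for e e'
  proof -
    have "(W * V) $$ (e, e') = (if e = e' then 1 else 0)" using W(2) that by simp
    thus ?thesis using that W(1)
      by (simp add: V_def scalar_prod_def atLeast0LessThan)
  qed
  thus ?thesis by (intro exI[of _ "\<lambda>e j. W $$ (e, j)"]) simp
qed

text \<open>
  Applying such functionals to both variables of \<open>(s, t) \<mapsto> (\<Sum>e\<in>E. co e * (s * t) ^ e)\<close> diagonalizes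
  this kernel: the matrix obtained has entries \<open>co e\<close> on the diagonal and \<open>0\<close> elsewhere. Both the rank
  and the signs of the coefficients can be read off.
\<close>

lemma sparse_kernel_coefficients:
  fixes co :: "nat \<Rightarrow> real"
  assumes "finite E" "0 < (t0::real)"
  shows "\<exists>(D :: nat) t w. (\<forall>j. t j \<in> {0<..<t0}) \<and>
    (\<forall>a\<in>E. \<forall>b\<in>E. (\<Sum>j<D. \<Sum>j'<D. w a j * w b j' * (\<Sum>e\<in>E. co e * (t j * t j') ^ e)) =
      (if a = b then co a else 0))"
proof -
  define D where "D = Suc (Max (insert 0 E))"
  have D: "e < D" if "e \<in> E" for e
    using that assms(1) Max_ge[of "insert 0 E" e] by (simp add: D_def less_Suc_eq_le)
  define t where "t j = t0 / (real j + 2)" for j :: nat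
  have t: "t j \<in> {0<..<t0}" for j using assms(2) by (simp add: t_def field_simps add_pos_nonneg)
  have "inj_on t {..<D}" using assms(2) by (auto simp: inj_on_def t_def)
  then obtain w where w: "\<And>e e'. e < D \<Longrightarrow> e' < D \<Longrightarrow> (\<Sum>j<D. w e j * t j ^ e') = (if e = e' then 1 else 0)"
    using coefficient_functionals by metis
  have functional: "(\<Sum>j<D. \<Sum>j'<D. w a j * w b j' * (\<Sum>e\<in>E. co e * (t j * t j') ^ e)) = (if a = b then co a else 0)"
    if ab: "a \<in> E" "b \<in> E" for a b
  proof -
    have "(\<Sum>j<D. \<Sum>j'<D. w a j * w b j' * (\<Sum>e\<in>E. co e * (t j * t j') ^ e)) =
      (\<Sum>j<D. \<Sum>j'<D. \<Sum>e\<in>E. co e * ((w a j * t j ^ e) * (w b j' * t j' ^ e)))"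
      by (simp add: sum_distrib_left power_mult_distrib mult_ac)
    also have "\<dots> = (\<Sum>j<D. \<Sum>e\<in>E. \<Sum>j'<D. co e * ((w a j * t j ^ e) * (w b j' * t j' ^ e)))"
      by (intro sum.cong refl sum.swap)
    also have "\<dots> = (\<Sum>e\<in>E. \<Sum>j<D. \<Sum>j'<D. co e * ((w a j * t j ^ e) * (w b j' * t j' ^ e)))"
      by (rule sum.swap)
    also have "\<dots> = (\<Sum>e\<in>E. co e * ((\<Sum>j<D. w a j * t j ^ e) * (\<Sum>j'<D. w b j' * t j' ^ e)))"
      by (simp only: sum_product, simp only: sum_distrib_left)
    also have "\<dots> = (\<Sum>e\<in>E. if e = a then (if a = b then co a else 0) else 0)"
      by (intro sum.cong refl) (use ab in \<open>auto simp: w D\<close>)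
    also have "\<dots> = (if a = b then co a else 0)" using ab assms(1) by simp
    finally show ?thesis .
  qed
  show ?thesis
    by (rule exI[of _ D], rule exI[of _ t], rule exI[of _ w]) (intro conjI allI ballI t functional)
qed

text \<open>
  A factorization of the kernel through \<open>k\<close> functions induces one of the invertible diagonal matrix
  with entries \<open>co e\<close>.
\<close>

lemma sparse_kernel_rank:
  fixes co :: "nat \<Rightarrow> real"
  assumes E: "finite E" "\<And>e. e \<in> E \<Longrightarrow> co e \<noteq> 0" and t0: "0 < t0"
    and fac: "\<And>s t. s \<in> {0<..<t0} \<Longrightarrow> t \<in> {0<..<t0} \<Longrightarrow>
      (\<Sum>e\<in>E. co e * (s * t) ^ e) = (\<Sum>m<k. B s m * C t m)"
  shows "card E \<le> k"
proof (rule ccontr)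
  assume "\<not> card E \<le> k"
  hence less: "k < card E" by simp
  obtain D :: nat and t w where tt: "\<forall>j. t j \<in> {0<..<t0}" and
    ww: "\<forall>a\<in>E. \<forall>b\<in>E.
      (\<Sum>j<D. \<Sum>j'<D. w a j * w b j' * (\<Sum>e\<in>E. co e * (t j * t j') ^ e)) = (if a = b then co a else 0)"
    using sparse_kernel_coefficients[OF E(1) t0, of co] by (elim exE conjE) (rule that)
  note t = tt[rule_format] and w = ww[rule_format]
  define B' where "B' a m = (\<Sum>j<D. w a j * B (t j) m)" for a m
  define C' where "C' a m = (\<Sum>j<D. w a j * C (t j) m)" for a m
  have BC: "(\<Sum>m<k. B' a m * C' b m) = (if a = b then co a else 0)" if ab: "a \<in> E" "b \<in> E" for a b
  proof -
    have "(\<Sum>m<k. B' a m * C' b m) =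
      (\<Sum>m<k. \<Sum>j<D. \<Sum>j'<D. w a j * w b j' * (B (t j) m * C (t j') m))"
      by (simp add: B'_def C'_def sum_product mult_ac)
    also have "\<dots> = (\<Sum>j<D. \<Sum>m<k. \<Sum>j'<D. w a j * w b j' * (B (t j) m * C (t j') m))"
      by (rule sum.swap)
    also have "\<dots> = (\<Sum>j<D. \<Sum>j'<D. \<Sum>m<k. w a j * w b j' * (B (t j) m * C (t j') m))"
      by (intro sum.cong refl sum.swap)
    also have "\<dots> = (\<Sum>j<D. \<Sum>j'<D. w a j * w b j' * (\<Sum>e\<in>E. co e * (t j * t j') ^ e))"
      by (simp add: fac[OF t t] sum_distrib_left)
    finally show ?thesis using w[OF ab] by simp
  qed
  obtain \<epsilon> where \<epsilon>: "bij_betw \<epsilon> {..<card E} E"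
    using ex_bij_betw_nat_finite[OF E(1)] atLeast0LessThan by metis
  obtain c where c: "\<exists>b<card E. c b \<noteq> 0" "\<And>m. m < k \<Longrightarrow> (\<Sum>b<card E. C' (\<epsilon> b) m * c b) = 0"
    using underdetermined_system_has_nonzero_solution[OF less, of "\<lambda>m b. C' (\<epsilon> b) m"] by blast
  have "c a = 0" if a: "a < card E" for a
  proof -
    have \<epsilon>E: "\<epsilon> b \<in> E" if "b < card E" for b using \<epsilon> that by (auto simp: bij_betw_def)
    have "co (\<epsilon> a) * c a = (\<Sum>b<card E. (if a = b then co (\<epsilon> a) else 0) * c b)"
      using a by (simp add: if_distrib[of "\<lambda>z. z * _"] cong: if_cong)
    also have "\<dots> = (\<Sum>b<card E. (if \<epsilon> a = \<epsilon> b then co (\<epsilon> a) else 0) * c b)"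
      using \<epsilon> a by (intro sum.cong refl) (auto simp: bij_betw_def inj_on_def)
    also have "\<dots> = (\<Sum>b<card E. (\<Sum>m<k. B' (\<epsilon> a) m * C' (\<epsilon> b) m) * c b)"
      using \<epsilon>E a by (intro sum.cong refl) (simp add: BC)
    also have "\<dots> = (\<Sum>b<card E. \<Sum>m<k. B' (\<epsilon> a) m * (C' (\<epsilon> b) m * c b))"
      by (intro sum.cong refl) (simp add: sum_distrib_left mult_ac)
    also have "\<dots> = (\<Sum>m<k. \<Sum>b<card E. B' (\<epsilon> a) m * (C' (\<epsilon> b) m * c b))" by (rule sum.swap)
    also have "\<dots> = 0" by (simp add: sum_distrib_left[symmetric] c(2))
    finally show "c a = 0" using E(2)[OF \<epsilon>E[OF a]] by simp
  qed
  thus False using c(1) by blast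
qed

section \<open>Weighted polynomials bound the rank\<close>

lemma rank_one_sum_entrywise:
  fixes A :: "real mat"
  assumes A: "A \<in> carrier_mat n n" and Z: "finite Z" "card Z \<le> k"
    and fac: "\<And>i j. i < n \<Longrightarrow> j < n \<Longrightarrow> A $$ (i, j) = (\<Sum>z\<in>Z. c z * (\<phi> z i * \<phi> z j))"
  shows "A \<in> symmetric_mats_rank_le n k UNIV"
    and "(\<And>z. z \<in> Z \<Longrightarrow> 0 \<le> c z) \<Longrightarrow> A \<in> psd_mats_rank_le n k UNIV"
proof -
  obtain \<epsilon> where \<epsilon>: "bij_betw \<epsilon> {..<card Z} Z"
    using ex_bij_betw_nat_finite[OF Z(1)] atLeast0LessThan by metis
  have "A $$ (i, j) = (\<Sum>m<card Z. (c (\<epsilon> m) * \<phi> (\<epsilon> m) i) * \<phi> (\<epsilon> m) j)" if "i < n" "j < n" for i j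
    unfolding fac[OF that] sum.reindex_bij_betw[OF \<epsilon>, symmetric] by (simp add: mult_ac)
  hence "vec_space.rank n A \<le> card Z"
    by (rule rank_le_if_factors[OF A])
  hence rank: "vec_space.rank n A \<le> k" using Z(2) by simp
  have sym: "A \<in> symmetric_mats n UNIV"
    using A by (auto simp: symmetric_mats_def fac mult_ac intro!: eq_matI)
  show "A \<in> symmetric_mats_rank_le n k UNIV" using sym rank by (simp add: symmetric_mats_rank_le_def)
  assume c: "\<And>z. z \<in> Z \<Longrightarrow> 0 \<le> c z"
  have "0 \<le> (\<Sum>i<n. \<Sum>j<n. v i * A $$ (i, j) * v j)" for v
  proof -
    have "(\<Sum>i<n. \<Sum>j<n. v i * A $$ (i, j) * v j) =
      (\<Sum>i<n. \<Sum>j<n. \<Sum>z\<in>Z. c z * ((v i * \<phi> z i) * (v j * \<phi> z j)))"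
      by (intro sum.cong refl) (simp add: fac sum_distrib_left sum_distrib_right mult_ac)
    also have "\<dots> = (\<Sum>i<n. \<Sum>z\<in>Z. \<Sum>j<n. c z * ((v i * \<phi> z i) * (v j * \<phi> z j)))"
      by (intro sum.cong refl sum.swap)
    also have "\<dots> = (\<Sum>z\<in>Z. \<Sum>i<n. \<Sum>j<n. c z * ((v i * \<phi> z i) * (v j * \<phi> z j)))" by (rule sum.swap)
    also have "\<dots> = (\<Sum>z\<in>Z. c z * (\<Sum>i<n. v i * \<phi> z i)^2)"
      by (simp only: power2_eq_square sum_product, simp only: sum_distrib_left)
    also have "0 \<le> \<dots>" using c by (intro sum_nonneg) auto
    finally show ?thesis .
  qed
  thus "A \<in> psd_mats_rank_le n k UNIV" using sym rank by (simp add: psd_mats_rank_le_def psd_mats_iff)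
qed

text \<open>
  Write the matrix as a Gram matrix of vectors \<open>u x\<close> in dimension \<open>l\<close>. Expanding every power of the
  inner products into monomials writes the image as a combination of as many matrices
  \<open>(\<phi> (u x) * \<phi> (u y))\<close> as the weights of the exponents add up to.
\<close>

lemma weighted_polynomial_preserves_rank:
  assumes f: "weighted_polynomial_on C l k f J" and l: "1 \<le> l" and A: "A \<in> psd_mats_rank_le n l J"
  shows "map_mat f A \<in> symmetric_mats_rank_le n k UNIV"
    and "C \<subseteq> {0..} \<Longrightarrow> map_mat f A \<in> psd_mats_rank_le n k UNIV"
proof -
  obtain r :: nat and a :: "nat \<Rightarrow> real" and i :: "nat \<Rightarrow> nat" where a: "\<And>t. t \<in> {1..r} \<Longrightarrow> a t \<in> C"
    and fx: "\<And>x. x \<in> J \<Longrightarrow> f x = (\<Sum>t=1..r. a t * x ^ i t)"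
    and wt: "(\<Sum>t=1..r. (i t + l - 1) choose (l - 1)) \<le> k"
    using f unfolding weighted_polynomial_on_def by blast
  obtain u where u: "\<And>x y. x < n \<Longrightarrow> y < n \<Longrightarrow> A $$ (x, y) = dot l (u x) (u y)"
    using psd_mat_rank_le_is_gram[OF A] by blast
  have "A \<in> symmetric_mats n J" using A by (simp add: psd_mats_rank_le_def psd_mats_def)
  note A' = symmetric_matsD[OF this]
  define Z where "Z = (SIGMA t:{1..r}. multi_indices l (i t))"
  define c where "c = (\<lambda>(t, \<alpha>). a t * multinomial_coeff \<alpha>)"
  have Z: "finite Z" "card Z \<le> k"
    using wt l by (auto simp: Z_def finite_multi_indices card_multi_indices)
  have fac: "map_mat f A $$ (x, y) = (\<Sum>z\<in>Z. c z * (monomial (snd z) (u x) * monomial (snd z) (u y)))"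
    if "x < n" "y < n" for x y
  proof -
    have "map_mat f A $$ (x, y) = (\<Sum>t=1..r. a t * dot l (u x) (u y) ^ i t)"
      using that A' fx u by simp
    also have "\<dots> = (\<Sum>t=1..r. \<Sum>\<alpha>\<in>multi_indices l (i t). a t * multinomial_coeff \<alpha> * (monomial \<alpha> (u x) * monomial \<alpha> (u y)))"
      by (simp add: inner_power_expansion sum_distrib_left mult_ac)
    also have "\<dots> = (\<Sum>z\<in>Z. c z * (monomial (snd z) (u x) * monomial (snd z) (u y)))"
      unfolding Z_def by (subst sum.Sigma) (auto simp: finite_multi_indices c_def case_prod_unfold)
    finally show ?thesis .
  qed
  have carrier: "map_mat f A \<in> carrier_mat n n" using A'(1) by simp
  show "map_mat f A \<in> symmetric_mats_rank_le n k UNIV"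
    by (rule rank_one_sum_entrywise(1)[OF carrier Z fac])
  assume C: "C \<subseteq> {0..}"
  have c: "0 \<le> c z" if "z \<in> Z" for z
  proof -
    have "fst z \<in> {1..r}" using that by (auto simp: Z_def)
    hence "0 \<le> a (fst z)" using a C by auto
    thus ?thesis using multinomial_coeff_pos[of "snd z"] by (simp add: c_def case_prod_unfold)
  qed
  show "map_mat f A \<in> psd_mats_rank_le n k UNIV"
    by (rule rank_one_sum_entrywise(2)[OF carrier Z fac c])
qed

lemma weighted_polynomial_on_of_poly:
  assumes f: "\<And>x. x \<in> J \<Longrightarrow> f x = poly p x"
    and C: "\<And>i. coeff p i \<noteq> 0 \<Longrightarrow> coeff p i \<in> C"
    and wt: "(\<Sum>i | coeff p i \<noteq> 0. (i + l - 1) choose (l - 1)) \<le> k"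
  shows "weighted_polynomial_on C l k f J"
proof -
  let ?S = "{i. coeff p i \<noteq> 0}"
  have fin: "finite ?S" by (rule finite_subset[of _ "{..degree p}"]) (auto intro: le_degree)
  obtain \<epsilon> where \<epsilon>: "bij_betw \<epsilon> {1..card ?S} ?S"
    using ex_bij_betw_nat_finite_1[OF fin] by blast
  have fx: "f x = (\<Sum>t=1..card ?S. coeff p (\<epsilon> t) * x ^ \<epsilon> t)" if "x \<in> J" for x
  proof -
    have "f x = (\<Sum>i\<le>degree p. coeff p i * x ^ i)" using f[OF that] by (simp add: poly_altdef)
    also have "\<dots> = (\<Sum>i\<in>?S. coeff p i * x ^ i)"
      by (rule sum.mono_neutral_right) (auto intro: le_degree)
    also have "\<dots> = (\<Sum>t=1..card ?S. coeff p (\<epsilon> t) * x ^ \<epsilon> t)"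
      by (rule sum.reindex_bij_betw[OF \<epsilon>, symmetric])
    finally show ?thesis .
  qed
  have wt': "(\<Sum>t=1..card ?S. (\<epsilon> t + l - 1) choose (l - 1)) \<le> k"
    using wt unfolding sum.reindex_bij_betw[OF \<epsilon>, symmetric] .
  have co: "\<forall>t\<in>{1..card ?S}. coeff p (\<epsilon> t) \<in> C" using \<epsilon> C by (auto simp: bij_betw_def)
  have inj: "inj_on \<epsilon> {1..card ?S}" using \<epsilon> by (simp add: bij_betw_def)
  show ?thesis unfolding weighted_polynomial_on_def
    by (rule exI[of _ "card ?S"], rule exI[of _ "\<lambda>t. coeff p (\<epsilon> t)"], rule exI[of _ \<epsilon>])
      (use fx wt' co inj in blast)
qed

lemma C_k_on_imp_continuous:
  assumes "C_k_on k f S"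
  shows "continuous_on S f"
proof -
  obtain g where g: "\<And>x. x \<in> S \<Longrightarrow> g 0 x = f x"
    "\<And>j x. j < k \<Longrightarrow> x \<in> S \<Longrightarrow> (g j has_real_derivative g (Suc j) x) (at x within S)"
    "continuous_on S (g k)"
    using assms unfolding C_k_on_def by blast
  have "continuous_on S (g 0)"
    using g(2)[of 0] g(3) by (cases k) (auto intro: DERIV_continuous_on)
  from continuous_on_eq[OF this g(1)] show ?thesis .
qed

section \<open>The kernel of a function on an interval\<close>

text \<open>
  The common features of \<open>[0, R)\<close> and \<open>(- R, R)\<close> that the argument needs. Whether \<open>I\<close> contains a
  negative number distinguishes the two cases throughout.
\<close>

locale entrywise_domain =
  fixes I :: "real set" and l :: nat
  assumes zero_mem: "0 \<in> I"
    and solid: "a \<in> I \<Longrightarrow> \<bar>b\<bar> \<le> a \<Longrightarrow> 0 \<le> b \<or> (\<exists>c\<in>I. c < 0) \<Longrightarrow> b \<in> I"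
    and open_right: "a \<in> I \<Longrightarrow> \<exists>b\<in>I. \<bar>a\<bar> < b"
    and l_ge_2: "2 \<le> l"
begin

text \<open>
  A set of vectors whose pairwise inner products all lie in \<open>I\<close>: the vectors whose squared
  norm lies in \<open>I\<close>, restricted to the nonnegative orthant if \<open>I\<close> has no negative elements. Then
  \<open>(x, y) \<mapsto> f (dot l x y)\<close> is a symmetric kernel on this set, and its Gram matrices of size \<open>n\<close> are
  images under \<open>f\<close> of admissible matrices.
\<close>

definition vectors :: "(nat \<Rightarrow> real) set" where
  "vectors = {x. dot l x x \<in> I \<and> ((\<forall>j<l. 0 \<le> x j) \<or> (\<exists>c\<in>I. c < 0))}"

definition plane_vec :: "real \<Rightarrow> real \<Rightarrow> nat \<Rightarrow> real" where
  "plane_vec a b j = (if j = 0 then a else if j = 1 then b else 0)"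

lemma dot_plane_vec: "dot l (plane_vec a b) (plane_vec c d) = a * c + b * d"
proof -
  obtain m where "l = Suc (Suc m)" using l_ge_2 by (metis Suc_le_D numeral_2_eq_2 Suc_le_mono)
  thus ?thesis by (simp add: sum.lessThan_Suc_shift plane_vec_def del: sum.lessThan_Suc)
qed

lemma plane_vec_in_vectors:
  assumes "b \<in> I" "x\<^sup>2 + y\<^sup>2 \<le> b" "0 \<le> x \<and> 0 \<le> y \<or> (\<exists>c\<in>I. c < 0)"
  shows "plane_vec x y \<in> vectors"
proof -
  have "x * x + y * y \<in> I"
    using assms(2) by (intro solid[OF assms(1)]) (auto simp: power2_eq_square)
  thus ?thesis using assms(3) by (auto simp: vectors_def dot_plane_vec) (auto simp: plane_vec_def)
qed

lemma dot_in_domain: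
  assumes x: "x \<in> vectors" and y: "y \<in> vectors"
  shows "dot l x y \<in> I"
proof -
  have "(\<Sum>j<l. (x j - y j)\<^sup>2) = dot l x x + dot l y y - 2 * dot l x y"
    "(\<Sum>j<l. (x j + y j)\<^sup>2) = dot l x x + dot l y y + 2 * dot l x y"
    by (simp_all add: power2_eq_square algebra_simps sum.distrib sum_subtractf sum_distrib_left)
  moreover have "0 \<le> (\<Sum>j<l. (x j - y j)\<^sup>2)" "0 \<le> (\<Sum>j<l. (x j + y j)\<^sup>2)" by (auto intro: sum_nonneg)
  ultimately have "2 * \<bar>dot l x y\<bar> \<le> dot l x x + dot l y y" by linarith
  hence "\<bar>dot l x y\<bar> \<le> dot l x x \<or> \<bar>dot l x y\<bar> \<le> dot l y y" by linarith
  moreover have "0 \<le> dot l x y \<or> (\<exists>c\<in>I. c < 0)"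
    using x y by (auto simp: vectors_def intro!: sum_nonneg)
  ultimately show ?thesis using solid x y unfolding vectors_def by blast
qed

lemma gram_matrix_in_psd_mats:
  assumes "\<And>i. i < n \<Longrightarrow> p i \<in> vectors"
  shows "mat n n (\<lambda>(i, j). dot l (p i) (p j)) \<in> psd_mats_rank_le n l I" (is "?A \<in> _")
proof -
  have "?A \<in> symmetric_mats n I"
    by (rule symmetric_matI) (auto simp: mult.commute intro: dot_in_domain assms)
  moreover have "?A \<in> psd_mats_rank_le n l UNIV"
    by (rule rank_one_sum_entrywise(2)[where Z = "{..<l}" and c = "\<lambda>_. 1" and \<phi> = "\<lambda>m i. p i m"]) auto
  ultimately show ?thesis by (auto simp: psd_mats_rank_le_def psd_mats_iff)
qed

text \<open>
  This is where \<open>k + 2 \<le> n\<close> enters: all Gram matrices of up to \<open>k + 2\<close> points are submatrices of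
  \<open>n \<times> n\<close> ones.
\<close>

lemma kernel_of_rank_preserver:
  fixes f :: "real \<Rightarrow> real"
  assumes n: "k + 2 \<le> n"
    and f: "\<And>A. A \<in> psd_mats_rank_le n l I \<Longrightarrow> vec_space.rank n (map_mat f A) \<le> k"
  shows "\<exists>r p d. r \<le> k \<and> (\<forall>i<r. p i \<in> vectors) \<and> (\<forall>x\<in>vectors. \<forall>y\<in>vectors.
    f (dot l x y) = (\<Sum>i<r. \<Sum>j<r. d x i * f (dot l (p i) (p j)) * d y j))"
proof (rule symmetric_kernel_decomposition[of vectors "\<lambda>x y. f (dot l x y)" k])
  show "f (dot l x y) = f (dot l y x)" for x y by (simp add: mult.commute)
  fix r p assume r: "r \<le> k + 2" and p: "\<forall>i<r. p i \<in> vectors"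
    and nd: "nondegenerate (\<lambda>x y. f (dot l x y)) p r"
  show "r \<le> k"
  proof (cases "r = 0")
    case False
    \<comment> \<open>Repeat the first point to reach a tuple of length \<open>n\<close>.\<close>
    define p' where "p' i = (if i < r then p i else p 0)" for i
    have "p' i \<in> vectors" for i using p False by (simp add: p'_def)
    from f[OF gram_matrix_in_psd_mats[OF this]] obtain B C where
      BC: "\<And>i j. i < n \<Longrightarrow> j < n \<Longrightarrow> f (dot l (p' i) (p' j)) = (\<Sum>m<k. B i m * C m j)"
      using factors_if_rank_le[of "map_mat f (mat n n (\<lambda>(i, j). dot l (p' i) (p' j)))" n k] by auto
    show ?thesis
    proof (rule nondegenerate_factor_bound[OF nd])
      show "f (dot l (p i) (p j)) = (\<Sum>m<k. B i m * C m j)" if "i < r" "j < r" for i j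
        using BC[of i j] that r n by (simp add: p'_def)
    qed
  qed simp
qed

definition kernel_rank_le :: "nat \<Rightarrow> (real \<Rightarrow> real) \<Rightarrow> bool" where
  "kernel_rank_le k f \<longleftrightarrow>
    (\<exists>B C. \<forall>x\<in>vectors. \<forall>y\<in>vectors. f (dot l x y) = (\<Sum>m<k. B x m * C y m))"

lemma rank_preserver_kernel_rank_le:
  assumes "k + 2 \<le> n"
    and "\<And>A. A \<in> psd_mats_rank_le n l I \<Longrightarrow> vec_space.rank n (map_mat f A) \<le> k"
  shows "kernel_rank_le k f"
proof -
  obtain r p d where r: "r \<le> k" and d: "\<And>x y. x \<in> vectors \<Longrightarrow> y \<in> vectors \<Longrightarrow>
    f (dot l x y) = (\<Sum>i<r. \<Sum>j<r. d x i * f (dot l (p i) (p j)) * d y j)"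
    using kernel_of_rank_preserver[OF assms] by blast
  define B where "B x m = (if m < r then d x m else 0)" for x m
  define C where "C y m = (\<Sum>j<r. f (dot l (p m) (p j)) * d y j)" for y m
  have "f (dot l x y) = (\<Sum>m<k. B x m * C y m)" if "x \<in> vectors" "y \<in> vectors" for x y
  proof -
    have "f (dot l x y) = (\<Sum>m<r. d x m * C y m)"
      unfolding d[OF that] by (simp add: C_def sum_distrib_left mult_ac)
    also have "\<dots> = (\<Sum>m<k. B x m * C y m)"
      by (rule sum.mono_neutral_cong_left) (use r in \<open>auto simp: B_def\<close>)
    finally show ?thesis .
  qed
  thus ?thesis unfolding kernel_rank_le_def by blast
qed

lemma psd_preserver_on_tuples:
  assumes f: "\<And>A. A \<in> psd_mats_rank_le n l I \<Longrightarrow> map_mat f A \<in> psd_mats_rank_le n k UNIV"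
    and r: "r \<le> n" and p: "\<And>i. i < r \<Longrightarrow> p i \<in> vectors"
  shows "0 \<le> (\<Sum>i<r. \<Sum>j<r. v i * f (dot l (p i) (p j)) * v j)"
proof (cases "r = 0")
  case False
  define p' where "p' i = (if i < r then p i else p 0)" for i
  have "p' i \<in> vectors" for i using p False by (simp add: p'_def)
  from f[OF gram_matrix_in_psd_mats[OF this]]
  have psd: "0 \<le> (\<Sum>i<n. \<Sum>j<n. w i * f (dot l (p' i) (p' j)) * w j)" for w
    by (auto simp: psd_mats_rank_le_def psd_mats_iff)
  have "0 \<le> (\<Sum>i<r. \<Sum>j<r. v i * f (dot l (p' i) (p' j)) * v j)"
    using psd_quadratic_form_on_tuple[where K = "\<lambda>i j. f (dot l (p' i) (p' j))" and p = "\<lambda>i. i" and r = r and n = n and v = v] psd r by auto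
  thus ?thesis by (simp add: p'_def)
qed simp

text \<open>
  Positivity is assumed for \<open>n\<close> points only; it propagates to any number \<open>D\<close> of points because the
  whole kernel is controlled by one Gram matrix of \<open>r \<le> k\<close> points.
\<close>

lemma psd_preserver_kernel_is_psd:
  assumes n: "k + 2 \<le> n"
    and f: "\<And>A. A \<in> psd_mats_rank_le n l I \<Longrightarrow> map_mat f A \<in> psd_mats_rank_le n k UNIV"
    and x: "\<And>j. x j \<in> vectors"
  shows "0 \<le> (\<Sum>j<D. \<Sum>j'<D. w j * w j' * f (dot l (x j) (x j')))"
proof -
  have "vec_space.rank n (map_mat f A) \<le> k" if "A \<in> psd_mats_rank_le n l I" for A
    using f[OF that] by (simp add: psd_mats_rank_le_def)
  from kernel_of_rank_preserver[OF n this] obtain r p d where r: "r \<le> k"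
    and p: "\<And>i. i < r \<Longrightarrow> p i \<in> vectors" and d: "\<And>x y. x \<in> vectors \<Longrightarrow> y \<in> vectors \<Longrightarrow>
      f (dot l x y) = (\<Sum>i<r. \<Sum>i'<r. d x i * f (dot l (p i) (p i')) * d y i')"
    by blast
  define W where "W i = (\<Sum>j<D. w j * d (x j) i)" for i
  have "(\<Sum>j<D. \<Sum>j'<D. w j * w j' * f (dot l (x j) (x j'))) =
    (\<Sum>j<D. \<Sum>j'<D. \<Sum>i<r. \<Sum>i'<r. f (dot l (p i) (p i')) * ((w j * d (x j) i) * (w j' * d (x j') i')))"
    by (simp add: d[OF x x] sum_distrib_left mult_ac)
  also have "\<dots> = (\<Sum>j<D. \<Sum>i<r. \<Sum>j'<D. \<Sum>i'<r. f (dot l (p i) (p i')) * ((w j * d (x j) i) * (w j' * d (x j') i')))"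
    by (intro sum.cong refl sum.swap)
  also have "\<dots> = (\<Sum>i<r. \<Sum>j<D. \<Sum>j'<D. \<Sum>i'<r. f (dot l (p i) (p i')) * ((w j * d (x j) i) * (w j' * d (x j') i')))"
    by (rule sum.swap)
  also have "\<dots> = (\<Sum>i<r. \<Sum>j<D. \<Sum>i'<r. \<Sum>j'<D. f (dot l (p i) (p i')) * ((w j * d (x j) i) * (w j' * d (x j') i')))"
    by (intro sum.cong refl sum.swap)
  also have "\<dots> = (\<Sum>i<r. \<Sum>i'<r. \<Sum>j<D. \<Sum>j'<D. f (dot l (p i) (p i')) * ((w j * d (x j) i) * (w j' * d (x j') i')))"
    by (intro sum.cong refl sum.swap)
  also have "\<dots> = (\<Sum>i<r. \<Sum>i'<r. f (dot l (p i) (p i')) * (W i * W i'))"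
    unfolding W_def by (simp only: sum_product, simp only: sum_distrib_left)
  also have "\<dots> = (\<Sum>i<r. \<Sum>i'<r. W i * f (dot l (p i) (p i')) * W i')"
    by (simp add: mult_ac)
  also have "0 \<le> \<dots>"
    by (rule psd_preserver_on_tuples[OF f _ p]) (use r n in auto)
  finally show ?thesis .
qed

section \<open>Finite kernel rank forces a polynomial\<close>

text \<open>
  The arguments \<open>s * y\<close> at which a relation coming from vectors with first coordinate \<open>s\<close> can be
  centred. These intervals exhaust the interior of \<open>I\<close> as \<open>s\<^sup>2\<close> grows.
\<close>

definition core :: "real \<Rightarrow> real set" where
  "core s = {x. \<bar>x\<bar> < s\<^sup>2 \<and> (0 < x \<or> (\<exists>c\<in>I. c < 0))}"

lemma core_interval: "core s = (if \<exists>c\<in>I. c < 0 then {- (s\<^sup>2)<..<s\<^sup>2} else {0<..<s\<^sup>2})"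
  by (auto simp: core_def abs_less_iff)

lemma open_core: "open (core s)" and convex_core: "convex (core s)"
  by (simp_all add: core_interval)

lemma core_subset:
  assumes "s\<^sup>2 \<in> I"
  shows "core s \<subseteq> I"
proof
  fix x assume "x \<in> core s"
  thus "x \<in> I" by (intro solid[OF assms]) (auto simp: core_def)
qed

text \<open>
  The \<open>k + 1\<close> vectors \<open>(s, j h)\<close> have linearly dependent images in the \<open>k\<close>-dimensional space of the
  factorization. Pairing the dependence with \<open>(x / s, \<delta> / h)\<close>, whose inner product with \<open>(s, j h)\<close> is
  \<open>x + j \<delta>\<close>, gives a relation with coefficients that depend neither on \<open>x\<close> nor on \<open>\<delta>\<close>. Two
  dimensions are what makes translation and dilation independent.
\<close>

lemma core_dilation_relation:
  assumes rank: "kernel_rank_le k f"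
    and s: "0 < s" "s\<^sup>2 \<in> I"
  shows "\<exists>T q. finite T \<and> T \<noteq> {} \<and> (\<forall>\<tau>\<in>T. q \<tau> \<noteq> 0) \<and> dilation_relation f T q (core s)"
proof -
  obtain B C where fac: "\<And>x y. x \<in> vectors \<Longrightarrow> y \<in> vectors \<Longrightarrow> f (dot l x y) = (\<Sum>m<k. B x m * C y m)"
    using rank unfolding kernel_rank_le_def by blast
  obtain b where b: "b \<in> I" "s\<^sup>2 < b" using open_right[OF s(2)] by auto
  define g where "g = sqrt (b - s\<^sup>2)"
  have g: "0 < g" "s\<^sup>2 + g\<^sup>2 = b" using b by (simp_all add: g_def)
  \<comment> \<open>The step \<open>h\<close> keeps \<open>s\<^sup>2 + (j h)\<^sup>2\<close> below \<open>b\<close> for all \<open>j \<le> k\<close>.\<close>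
  define h where "h = g / real (Suc k)"
  have h: "0 < h" using g by (simp add: h_def)
  have pts: "plane_vec s (real j * h) \<in> vectors" if "j < Suc k" for j
  proof (rule plane_vec_in_vectors[OF b(1)])
    have "real j * h \<le> real (Suc k) * h" using that h by (intro mult_right_mono) auto
    also have "\<dots> = g" by (simp add: h_def)
    finally have "(real j * h)\<^sup>2 \<le> g\<^sup>2" using h by (intro power_mono) auto
    thus "s\<^sup>2 + (real j * h)\<^sup>2 \<le> b" using g(2) by linarith
  qed (use s h in auto)
  obtain q where q: "\<exists>j<Suc k. q j \<noteq> 0"
    "\<And>m. m < k \<Longrightarrow> (\<Sum>j<Suc k. B (plane_vec s (real j * h)) m * q j) = 0"
    using underdetermined_system_has_nonzero_solution[of k "Suc k" "\<lambda>m j. B (plane_vec s (real j * h)) m"] by blast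
  have rel: "(\<Sum>j<Suc k. q j * f (s * y1 + real j * h * y2)) = 0" if y: "plane_vec y1 y2 \<in> vectors" for y1 y2
  proof -
    have "(\<Sum>j<Suc k. q j * f (s * y1 + real j * h * y2)) =
      (\<Sum>j<Suc k. q j * (\<Sum>m<k. B (plane_vec s (real j * h)) m * C (plane_vec y1 y2) m))"
      by (rule sum.cong[OF refl]) (simp add: fac[OF pts y, symmetric] dot_plane_vec)
    also have "\<dots> = (\<Sum>j<Suc k. \<Sum>m<k. C (plane_vec y1 y2) m * (B (plane_vec s (real j * h)) m * q j))"
      by (simp only: sum_distrib_left mult_ac)
    also have "\<dots> = (\<Sum>m<k. \<Sum>j<Suc k. C (plane_vec y1 y2) m * (B (plane_vec s (real j * h)) m * q j))"
      by (rule sum.swap)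
    also have "\<dots> = 0" by (simp only: sum_distrib_left[symmetric]) (simp add: q(2) del: sum.lessThan_Suc)
    finally show ?thesis .
  qed
  define Q where "Q = {j. j < Suc k \<and> q j \<noteq> 0}"
  define T where "T = real ` Q"
  define q' where "q' \<tau> = q (nat \<lfloor>\<tau>\<rfloor>)" for \<tau> :: real
  have Q: "finite Q" by (simp add: Q_def)
  have "dilation_relation f T q' (core s)"
    unfolding dilation_relation_def
  proof
    fix c assume c: "c \<in> core s"
    define \<eta> where "\<eta> = min (s\<^sup>2 - \<bar>c\<bar>) (min (h * g) (if \<exists>c\<in>I. c < 0 then 1 else c))"
    have "0 < \<eta>" using c h g by (auto simp: \<eta>_def core_def)
    moreover have "(\<Sum>\<tau>\<in>T. q' \<tau> * f (x + \<tau> * \<delta>)) = 0" if x: "\<bar>x - c\<bar> < \<eta>" "0 < \<delta>" "\<delta> < \<eta>" for x \<delta>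
    proof -
      have "plane_vec (x / s) (\<delta> / h) \<in> vectors"
      proof (rule plane_vec_in_vectors[OF b(1)])
        have "\<bar>x\<bar> \<le> s\<^sup>2" using x(1) by (auto simp: \<eta>_def)
        hence "\<bar>x / s\<bar> \<le> \<bar>s\<bar>" using s by (simp add: field_simps power2_eq_square abs_mult)
        hence "(x / s)\<^sup>2 \<le> s\<^sup>2" by (simp only: abs_le_square_iff)
        moreover have "\<delta> / h \<le> g" using x(3) h by (simp add: \<eta>_def field_simps)
        hence "(\<delta> / h)\<^sup>2 \<le> g\<^sup>2" using x(2) h by (intro power_mono) auto
        ultimately show "(x / s)\<^sup>2 + (\<delta> / h)\<^sup>2 \<le> b" using g(2) by linarith
        show "0 \<le> x / s \<and> 0 \<le> \<delta> / h \<or> (\<exists>c\<in>I. c < 0)"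
          using x s h by (auto simp: \<eta>_def split: if_splits)
      qed
      hence "0 = (\<Sum>j<Suc k. q j * f (x + real j * \<delta>))"
        using rel[of "x / s" "\<delta> / h"] s h by (simp del: sum.lessThan_Suc)
      also have "\<dots> = (\<Sum>j\<in>Q. q j * f (x + real j * \<delta>))"
        by (rule sum.mono_neutral_right) (auto simp: Q_def)
      also have "\<dots> = (\<Sum>\<tau>\<in>T. q' \<tau> * f (x + \<tau> * \<delta>))"
        unfolding T_def by (subst sum.reindex) (auto simp: q'_def inj_on_def)
      finally show ?thesis by simp
    qed
    ultimately show "\<exists>\<eta>>0. \<forall>x \<delta>. \<bar>x - c\<bar> < \<eta> \<longrightarrow> 0 < \<delta> \<longrightarrow> \<delta> < \<eta> \<longrightarrow>
      (\<Sum>\<tau>\<in>T. q' \<tau> * f (x + \<tau> * \<delta>)) = 0" by blast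
  qed
  moreover have "finite T" "T \<noteq> {}" "\<forall>\<tau>\<in>T. q' \<tau> \<noteq> 0"
    using q(1) Q by (auto simp: T_def q'_def Q_def)
  ultimately show ?thesis by blast
qed

text \<open>
  On each interval \<open>core s\<close> the function is a polynomial; these polynomials agree on a common interval
  to the right of \<open>0\<close> and are therefore all equal.
\<close>

lemma polynomial_on_interior:
  assumes rank: "kernel_rank_le k f"
    and reg: "continuous_on I f \<or> mono_on (I \<inter> {0..}) f \<and> \<not> (\<exists>c\<in>I. c < 0)"
  shows "\<exists>p. \<forall>x\<in>I. 0 < x \<or> (\<exists>c\<in>I. c < 0) \<longrightarrow> f x = poly p x"
proof -
  have loc: "\<exists>p. \<forall>x\<in>core s. f x = poly p x" if s: "0 < s" "s\<^sup>2 \<in> I" for s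
  proof -
    obtain T q where T: "finite T" "T \<noteq> {}" "\<And>\<tau>. \<tau> \<in> T \<Longrightarrow> q \<tau> \<noteq> 0" "dilation_relation f T q (core s)"
      using core_dilation_relation[OF rank s] by blast
    have "continuous_on (core s) f"
    proof (cases "continuous_on I f")
      case True
      thus ?thesis using core_subset[OF s(2)] continuous_on_subset by blast
    next
      case False
      hence mono: "mono_on (I \<inter> {0..}) f" and pos: "\<not> (\<exists>c\<in>I. c < 0)" using reg by auto
      have "mono_on (core s) f"
      proof (rule mono_onI)
        fix x y assume "x \<in> core s" "y \<in> core s" "x \<le> y"
        moreover from this have "x \<in> I \<inter> {0..}" "y \<in> I \<inter> {0..}"
          using core_subset[OF s(2)] pos by (auto simp: core_def less_imp_le)
        ultimately show "f x \<le> f y" using mono_onD[OF mono] by blast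
      qed
      from mono_dilation_relation_imp_continuous[OF open_core this T] show ?thesis .
    qed
    from dilation_relation_imp_polynomial[OF open_core convex_core this T] show ?thesis .
  qed
  obtain a0 where a0: "a0 \<in> I" "0 < a0" using open_right[OF zero_mem] by auto
  obtain p where p: "\<And>x. x \<in> core (sqrt a0) \<Longrightarrow> f x = poly p x"
    using loc[of "sqrt a0"] a0 by auto
  have "f x = poly p x" if x: "x \<in> I" "0 < x \<or> (\<exists>c\<in>I. c < 0)" for x
  proof -
    obtain a where a: "a \<in> I" "\<bar>x\<bar> < a" using open_right[OF x(1)] by blast
    define a' where "a' = max a a0"
    have a': "a' \<in> I" "0 < a'" using a a0 by (auto simp: a'_def max_def)
    obtain p' where p': "\<And>x. x \<in> core (sqrt a') \<Longrightarrow> f x = poly p' x"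
      using loc[of "sqrt a'"] a' by auto
    have "{0<..<a0} \<subseteq> {x. poly (p' - p) x = 0}"
    proof
      fix x assume "x \<in> {0<..<a0}"
      hence "x \<in> core (sqrt a0)" "x \<in> core (sqrt a')"
        using a0 a' by (auto simp: core_def a'_def)
      thus "x \<in> {x. poly (p' - p) x = 0}" using p[of x] p'[of x] by simp
    qed
    hence "\<not> finite {x. poly (p' - p) x = 0}"
      using infinite_Ioo[OF a0(2)] finite_subset by blast
    hence "p' = p" using poly_roots_finite[of "p' - p"] by auto
    moreover have "x \<in> core (sqrt a')" using x a a' by (auto simp: core_def a'_def)
    ultimately show ?thesis using p' by auto
  qed
  thus ?thesis by blast
qed

lemma dots_cover_domain:
  assumes "a \<in> I"
  shows "\<exists>x\<in>vectors. \<exists>y\<in>vectors. dot l x y = a"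
proof -
  define s where "s = sqrt \<bar>a\<bar>"
  have s: "s * s = \<bar>a\<bar>" "0 \<le> s" by (simp_all add: s_def)
  obtain b where b: "b \<in> I" "\<bar>a\<bar> < b" using open_right[OF assms] by blast
  show ?thesis
  proof (cases "0 \<le> a")
    case True
    have "plane_vec s 0 \<in> vectors"
      by (rule plane_vec_in_vectors[OF b(1)]) (use b s in \<open>auto simp: power2_eq_square\<close>)
    moreover have "dot l (plane_vec s 0) (plane_vec s 0) = a" using s True by (simp add: dot_plane_vec)
    ultimately show ?thesis by blast
  next
    case False
    have "\<exists>c\<in>I. c < 0" using False assms by (meson not_le)
    hence "plane_vec s 0 \<in> vectors" "plane_vec (- s) 0 \<in> vectors"
      by (intro plane_vec_in_vectors[OF b(1)]; use b s in \<open>auto simp: power2_eq_square\<close>)+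
    moreover have "dot l (plane_vec s 0) (plane_vec (- s) 0) = a" using s False by (simp add: dot_plane_vec)
    ultimately show ?thesis by blast
  qed
qed

lemma sequence_to_zero:
  "\<exists>x. x \<longlonglongrightarrow> 0 \<and> (\<forall>m::nat. 0 < x m \<and> 2 * x m \<in> I \<and> x m \<in> I)"
proof -
  obtain a where a: "a \<in> I" "0 < a" using open_right[OF zero_mem] by auto
  define x where "x m = a / 2 * inverse (real (Suc m))" for m
  have le: "2 * x m \<le> a" "0 < x m" for m using a by (auto simp: x_def field_simps)
  have "x \<longlonglongrightarrow> a / 2 * 0"
    unfolding x_def by (intro tendsto_mult tendsto_const LIMSEQ_inverse_real_of_nat)
  moreover have "2 * x m \<in> I" "x m \<in> I" for m
    using le[of m] by (auto intro!: solid[OF a(1)])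
  ultimately show ?thesis using le by (intro exI[of _ x]) auto
qed

lemma continuous_preserver_is_polynomial:
  assumes rank: "kernel_rank_le k f"
    and cont: "continuous_on I f"
  shows "\<exists>p. \<forall>x\<in>I. f x = poly p x"
proof -
  obtain p where p: "\<And>x. x \<in> I \<Longrightarrow> 0 < x \<or> (\<exists>c\<in>I. c < 0) \<Longrightarrow> f x = poly p x"
    using polynomial_on_interior[OF rank] cont by blast
  have "f 0 = poly p 0"
  proof -
    obtain x :: "nat \<Rightarrow> real" where x: "x \<longlonglongrightarrow> 0" "\<And>m. 0 < x m" "\<And>m. x m \<in> I"
      using sequence_to_zero by blast
    have "(\<lambda>m. f (x m)) \<longlonglongrightarrow> f 0"
      using cont zero_mem x unfolding continuous_on_sequentially comp_def by blast
    moreover have "(\<lambda>m. poly p (x m)) \<longlonglongrightarrow> poly p 0"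
      using x(1) by (intro tendsto_intros)
    ultimately show ?thesis using p x LIMSEQ_unique by simp
  qed
  hence "f x = poly p x" if "x \<in> I" for x
    using p[OF that] that by (cases "x = 0") force+
  thus ?thesis by blast
qed

text \<open>
  Evaluate the image of the Gram matrix with entries \<open>a, a, a, b\<close>, where \<open>0 \<le> a \<le> b\<close>, at the vector
  \<open>(1, - 1)\<close>: the value is \<open>f b - f a\<close>.
\<close>

lemma psd_preserver_mono:
  assumes n: "2 \<le> n"
    and f: "\<And>A. A \<in> psd_mats_rank_le n l I \<Longrightarrow> map_mat f A \<in> psd_mats_rank_le n k UNIV"
  shows "mono_on (I \<inter> {0..}) f"
proof (rule mono_onI)
  fix a b assume ab: "a \<in> I \<inter> {0..}" "b \<in> I \<inter> {0..}" "a \<le> b"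
  define p where "p i = (if i = 0 then plane_vec (sqrt a) 0 else plane_vec (sqrt a) (sqrt (b - a)))" for i :: nat
  have p: "p i \<in> vectors" for i
    unfolding p_def by (auto intro!: plane_vec_in_vectors[of b]) (use ab in auto)
  have "0 \<le> (\<Sum>i<2. \<Sum>j<2. (if i = 0 then 1 else - 1) * f (dot l (p i) (p j)) * (if j = 0 then 1 else - 1))"
    by (rule psd_preserver_on_tuples[OF f n p])
  thus "f a \<le> f b"
    using ab by (simp add: numeral_2_eq_2 p_def dot_plane_vec)
qed

text \<open>
  Only the value at \<open>0\<close> is not settled by the behaviour on the interior. Monotonicity gives
  \<open>f 0 \<le> p 0\<close>. For the converse take the vectors \<open>(s, 0)\<close>, \<open>(0, s)\<close>, \<open>(s, s)\<close>: one pair is orthogonal,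
  so \<open>f 0\<close> occurs, and the form at \<open>(1, 1, - 2)\<close> tends to \<open>2 f 0 - 2 p 0\<close> as \<open>s\<close> tends to \<open>0\<close>.
\<close>

lemma psd_preserver_is_polynomial:
  assumes n: "3 \<le> n"
    and f: "\<And>A. A \<in> psd_mats_rank_le n l I \<Longrightarrow> map_mat f A \<in> psd_mats_rank_le n k UNIV"
    and rank: "kernel_rank_le k f"
    and pos: "\<not> (\<exists>c\<in>I. c < 0)"
  shows "\<exists>p. \<forall>x\<in>I. f x = poly p x"
proof -
  have mono: "mono_on (I \<inter> {0..}) f"
    by (rule psd_preserver_mono[OF _ f]) (use n in auto)
  obtain p where p: "\<And>x. x \<in> I \<Longrightarrow> 0 < x \<Longrightarrow> f x = poly p x"
    using polynomial_on_interior[OF rank] mono pos by blast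
  obtain x :: "nat \<Rightarrow> real" where x: "x \<longlonglongrightarrow> 0" "\<And>m. 0 < x m" "\<And>m. x m \<in> I" "\<And>m. 2 * x m \<in> I"
    using sequence_to_zero by blast
  have lim: "(\<lambda>m. poly p (c * x m)) \<longlonglongrightarrow> poly p (c * 0)" for c
    using x(1) by (intro tendsto_intros)
  have "f 0 \<le> poly p (x m)" for m
    using mono_onD[OF mono, of 0 "x m"] x(2,3)[of m] zero_mem p[of "x m"] by auto
  hence "f 0 \<le> poly p 0" using LIMSEQ_le_const[of "\<lambda>m. poly p (x m)"] lim[of 1] by auto
  moreover have "3 * poly p (x m) - 2 * poly p (2 * x m) \<le> f 0" for m
  proof -
    define s where "s = sqrt (x m)"
    have s: "s * s = x m" "0 \<le> s" using x(2)[of m] by (auto simp: s_def)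
    define u where "u i = (if i = 0 then plane_vec s 0 else if i = 1 then plane_vec 0 s else plane_vec s s)" for i :: nat
    have u: "u i \<in> vectors" for i
      unfolding u_def using s x(2)[of m]
      by (auto intro!: plane_vec_in_vectors[OF x(4)[of m]] simp: power2_eq_square)
    define v where "v i = (if i = 0 \<or> i = 1 then 1 else - 2 :: real)" for i :: nat
    have "0 \<le> (\<Sum>i<3. \<Sum>j<3. v i * f (dot l (u i) (u j)) * v j)"
      by (rule psd_preserver_on_tuples[OF f n u])
    also have "\<dots> = 4 * f (2 * x m) - 6 * f (x m) + 2 * f 0"
      by (simp add: numeral_3_eq_3 v_def u_def dot_plane_vec s)
    finally show ?thesis using p[OF x(3,2)[of m]] p[OF x(4)[of m]] x(2)[of m] by simp
  qed
  hence "3 * poly p (1 * 0) - 2 * poly p (2 * 0) \<le> f 0"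
    using LIMSEQ_le_const2[OF tendsto_diff[OF tendsto_mult[OF tendsto_const lim[of 1]]
      tendsto_mult[OF tendsto_const lim[of 2]]], of 3 2 "f 0"] by auto
  ultimately have "f 0 = poly p 0" by simp
  hence "f x = poly p x" if "x \<in> I" for x
    using p[OF that] that pos by (cases "x = 0") force+
  thus ?thesis by blast
qed

section \<open>Weights and signs of the coefficients\<close>

text \<open>
  The kernel \<open>p (dot l x y)\<close> is a combination, with nonzero coefficients, of the products of monomials
  whose degree is an exponent of \<open>p\<close>. Their number is the sum of the weights, and on the curve with
  base-\<open>M\<close> exponents it becomes a kernel in \<open>s * t\<close> with the same number of terms.
\<close>

lemma polynomial_weight_bound:
  assumes rank: "kernel_rank_le k f"
    and f: "\<And>x. x \<in> I \<Longrightarrow> f x = poly p x"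
  shows "(\<Sum>i | coeff p i \<noteq> 0. (i + l - 1) choose (l - 1)) \<le> k"
proof -
  obtain B C where fac: "\<And>x y. x \<in> vectors \<Longrightarrow> y \<in> vectors \<Longrightarrow> f (dot l x y) = (\<Sum>m<k. B x m * C y m)"
    using rank unfolding kernel_rank_le_def by blast
  define S where "S = {i. coeff p i \<noteq> 0}"
  have S: "finite S" "\<And>i. i \<in> S \<Longrightarrow> i \<le> degree p"
    by (rule finite_subset[of _ "{..degree p}"]) (auto simp: S_def intro: le_degree)
  \<comment> \<open>All entries of the multi-indices in question are at most \<open>degree p\<close>, hence digits in base \<open>M\<close>.\<close>
  define M where "M = Suc (degree p)"
  define Z where "Z = (\<Union>i\<in>S. multi_indices l i)"
  have Z: "finite Z" using S by (simp add: Z_def finite_multi_indices)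
  have inj: "inj_on (digits_value M) Z"
  proof (rule inj_onI)
    have len: "length \<alpha> = l \<and> (\<forall>b\<in>set \<alpha>. b < M)" if "\<alpha> \<in> Z" for \<alpha>
    proof -
      have "sum_list \<alpha> \<le> degree p" "length \<alpha> = l" using that S by (auto simp: Z_def multi_indices_def)
      thus ?thesis using member_le_sum_list[of _ \<alpha>] by (force simp: M_def less_Suc_eq_le)
    qed
    fix \<alpha> \<beta> assume "\<alpha> \<in> Z" "\<beta> \<in> Z" "digits_value M \<alpha> = digits_value M \<beta>"
    thus "\<alpha> = \<beta>" using len by (intro digits_value_inj[of \<alpha> \<beta> M]) auto
  qed
  define E where "E = digits_value M ` Z"
  define dec where "dec = the_inv_into Z (digits_value M)"
  have dec: "dec (digits_value M \<alpha>) = \<alpha>" if "\<alpha> \<in> Z" for \<alpha>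
    unfolding dec_def by (rule the_inv_into_f_f[OF inj that])
  define co where "co e = coeff p (sum_list (dec e)) * multinomial_coeff (dec e)" for e
  obtain a where a: "a \<in> I" "0 < a" using open_right[OF zero_mem] by auto
  \<comment> \<open>For \<open>t < t0\<close> each coordinate of the curve has square at most \<open>t\<close>, so the squared norm is
    at most \<open>l t \<le> a\<close>.\<close>
  define t0 where "t0 = min 1 (a / real l)"
  have t0: "0 < t0" using a l_ge_2 by (simp add: t0_def)
  define curve where "curve t j = t ^ (M ^ j)" for t :: real and j :: nat
  have curve: "curve t \<in> vectors" if "t \<in> {0<..<t0}" for t
  proof -
    have t: "0 < t" "t \<le> 1" "real l * t \<le> a"
      using that l_ge_2 by (auto simp: t0_def field_simps)
    have "curve t j * curve t j \<le> t" for j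
    proof -
      have "1 \<le> M ^ j" by (simp add: M_def)
      hence "curve t j \<le> t ^ 1" unfolding curve_def using t by (intro power_decreasing) auto
      moreover have "0 \<le> curve t j" "curve t j \<le> 1" using t by (auto simp: curve_def intro: power_le_one)
      ultimately have "curve t j * curve t j \<le> curve t j" "curve t j \<le> t"
        by (auto intro: mult_left_le)
      thus ?thesis by linarith
    qed
    hence "dot l (curve t) (curve t) \<le> (\<Sum>j<l. t)" by (intro sum_mono) auto
    hence "dot l (curve t) (curve t) \<le> a" using t by simp
    moreover have "0 \<le> dot l (curve t) (curve t)" by (intro sum_nonneg) auto
    ultimately have "dot l (curve t) (curve t) \<in> I" by (intro solid[OF a(1)]) auto
    thus ?thesis using t by (simp add: vectors_def curve_def)
  qed
  have expand: "f (dot l (curve s) (curve t)) = (\<Sum>e\<in>E. co e * (s * t) ^ e)"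
    if "s \<in> {0<..<t0}" "t \<in> {0<..<t0}" for s t
  proof -
    have mon: "monomial \<alpha> (curve r) = r ^ digits_value M \<alpha>" for \<alpha> r
      unfolding curve_def by (rule monomial_on_digit_curve)
    have "f (dot l (curve s) (curve t)) = poly p (dot l (curve s) (curve t))"
      using f[OF dot_in_domain[OF curve curve]] that by blast
    also have "\<dots> = (\<Sum>i\<le>degree p. coeff p i * dot l (curve s) (curve t) ^ i)"
      by (rule poly_altdef)
    also have "\<dots> = (\<Sum>i\<in>S. coeff p i * dot l (curve s) (curve t) ^ i)"
      by (rule sum.mono_neutral_right) (use S in \<open>auto simp: S_def\<close>)
    also have "\<dots> = (\<Sum>i\<in>S. \<Sum>\<alpha>\<in>multi_indices l i.
        coeff p (sum_list \<alpha>) * multinomial_coeff \<alpha> * (s * t) ^ digits_value M \<alpha>)"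
      unfolding inner_power_expansion sum_distrib_left mon
      by (intro sum.cong refl) (auto simp: multi_indices_def power_mult_distrib)
    also have "\<dots> = (\<Sum>\<alpha>\<in>Z. coeff p (sum_list \<alpha>) * multinomial_coeff \<alpha> * (s * t) ^ digits_value M \<alpha>)"
      unfolding Z_def using S(1)
      by (intro sum.UNION_disjoint[symmetric]) (auto simp: finite_multi_indices multi_indices_disjoint)
    also have "\<dots> = (\<Sum>e\<in>E. co e * (s * t) ^ e)"
      unfolding E_def by (subst sum.reindex[OF inj]) (simp add: co_def dec)
    finally show ?thesis .
  qed
  have "card E \<le> k"
  proof (rule sparse_kernel_rank[OF _ _ t0])
    show "finite E" using Z by (simp add: E_def)
    show "co e \<noteq> 0" if "e \<in> E" for e
      using that multinomial_coeff_pos less_imp_neq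
      by (fastforce simp: E_def co_def dec Z_def S_def multi_indices_def)
    show "(\<Sum>e\<in>E. co e * (s * t) ^ e) = (\<Sum>m<k. B (curve s) m * C (curve t) m)"
      if "s \<in> {0<..<t0}" "t \<in> {0<..<t0}" for s t
      using expand[OF that] fac[OF curve curve] that by metis
  qed
  moreover have "card E = card Z" unfolding E_def by (rule card_image[OF inj])
  moreover have "card Z = (\<Sum>i\<in>S. card (multi_indices l i))"
    unfolding Z_def by (rule card_UN_disjoint) (use S in \<open>auto simp: finite_multi_indices multi_indices_disjoint\<close>)
  ultimately show ?thesis using l_ge_2 by (simp add: card_multi_indices S_def)
qed

lemma kernel_rank_0_imp_zero:
  assumes "kernel_rank_le 0 f" "a \<in> I"
  shows "f a = 0"
  using dots_cover_domain[OF assms(2)] assms(1) unfolding kernel_rank_le_def by auto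

text \<open>
  Along vectors \<open>(t, 0)\<close> the kernel is \<open>p (s * t)\<close>, and each coefficient of \<open>p\<close> is a value of its
  quadratic form.
\<close>

lemma psd_preserver_coeffs_nonneg:
  assumes n: "k + 2 \<le> n"
    and psd: "\<And>A. A \<in> psd_mats_rank_le n l I \<Longrightarrow> map_mat f A \<in> psd_mats_rank_le n k UNIV"
    and f: "\<And>x. x \<in> I \<Longrightarrow> f x = poly p x"
  shows "0 \<le> coeff p i"
proof (cases "i \<le> degree p")
  case True
  obtain a where a: "a \<in> I" "0 < a" using open_right[OF zero_mem] by auto
  have vecs: "plane_vec t 0 \<in> vectors" if "t \<in> {0<..<sqrt a}" for t
  proof (rule plane_vec_in_vectors[OF a(1)])
    have "t\<^sup>2 \<le> (sqrt a)\<^sup>2" using that by (intro power_mono) auto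
    thus "t\<^sup>2 + 0\<^sup>2 \<le> a" using a by simp
  qed (use that in auto)
  have "0 < sqrt a" using a by simp
  from sparse_kernel_coefficients[OF finite_atMost[of "degree p"] this, of "coeff p"]
  obtain D :: nat and t w where tt: "\<forall>j. t j \<in> {0<..<sqrt a}" and
    ww: "\<forall>a\<in>{..degree p}. \<forall>b\<in>{..degree p}.
      (\<Sum>j<D. \<Sum>j'<D. w a j * w b j' * (\<Sum>e\<le>degree p. coeff p e * (t j * t j') ^ e)) =
      (if a = b then coeff p a else 0)"
    by (elim exE conjE) (rule that)
  note t = tt[rule_format] and w = ww[rule_format]
  have "f (dot l (plane_vec (t j) 0) (plane_vec (t j') 0)) = (\<Sum>e\<le>degree p. coeff p e * (t j * t j') ^ e)" for j j'
    using f[OF dot_in_domain[OF vecs[OF t] vecs[OF t]], of j j'] by (simp add: dot_plane_vec poly_altdef)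
  thus ?thesis
    using psd_preserver_kernel_is_psd[OF n psd, of "\<lambda>j. plane_vec (t j) 0" "w i" D] vecs[OF t] w[of i i] True
    by simp
qed (simp add: coeff_eq_0)

section \<open>The characterizations\<close>

lemma rank_preservers:
  assumes n: "k + 2 \<le> n" and cont: "continuous_on I f"
  shows "(\<forall>A \<in> psd_mats_rank_le n l I. map_mat f A \<in> symmetric_mats_rank_le n k UNIV)
    \<longleftrightarrow> weighted_polynomial_on UNIV l k f I"
proof
  assume *: "\<forall>A \<in> psd_mats_rank_le n l I. map_mat f A \<in> symmetric_mats_rank_le n k UNIV"
  have rank: "kernel_rank_le k f"
    by (rule rank_preserver_kernel_rank_le[OF n]) (use * in \<open>auto simp: symmetric_mats_rank_le_def\<close>)
  obtain p where p: "\<forall>x\<in>I. f x = poly p x"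
    using continuous_preserver_is_polynomial[OF rank cont] by blast
  show "weighted_polynomial_on UNIV l k f I"
    by (rule weighted_polynomial_on_of_poly[where p = p])
      (use p polynomial_weight_bound[OF rank] in auto)
next
  assume f: "weighted_polynomial_on UNIV l k f I"
  show "\<forall>A \<in> psd_mats_rank_le n l I. map_mat f A \<in> symmetric_mats_rank_le n k UNIV"
    using weighted_polynomial_preserves_rank(1)[OF f] l_ge_2 by simp
qed

text \<open>
  Without continuity of \<open>f\<close> and for \<open>k > 0\<close> one has \<open>n \<ge> 3\<close>, and positivity supplies the regularity; for
  \<open>k = 0\<close> the kernel, and with it \<open>f\<close>, vanishes identically.
\<close>

lemma psd_rank_preservers:
  assumes n: "k + 2 \<le> n" and reg: "continuous_on I f \<or> \<not> (\<exists>c\<in>I. c < 0)"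
  shows "(\<forall>A \<in> psd_mats_rank_le n l I. map_mat f A \<in> psd_mats_rank_le n k UNIV)
    \<longleftrightarrow> weighted_polynomial_on {0..} l k f I"
proof
  assume *: "\<forall>A \<in> psd_mats_rank_le n l I. map_mat f A \<in> psd_mats_rank_le n k UNIV"
  have rank: "kernel_rank_le k f"
    by (rule rank_preserver_kernel_rank_le[OF n]) (use * in \<open>auto simp: psd_mats_rank_le_def\<close>)
  have "\<exists>p. \<forall>x\<in>I. f x = poly p x"
  proof (cases "continuous_on I f")
    case True
    show ?thesis by (rule continuous_preserver_is_polynomial[OF rank True])
  next
    case False
    hence pos: "\<not> (\<exists>c\<in>I. c < 0)" using reg by simp
    show ?thesis
    proof (cases "k = 0")
      case True
      hence "\<forall>x\<in>I. f x = poly 0 x" using kernel_rank_0_imp_zero[of f] rank by simp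
      thus ?thesis by blast
    next
      case False
      show ?thesis
        by (rule psd_preserver_is_polynomial[OF _ _ rank pos, of n]) (use n False * in auto)
    qed
  qed
  then obtain p where p: "\<forall>x\<in>I. f x = poly p x" by blast
  have "0 \<le> coeff p i" for i
    by (rule psd_preserver_coeffs_nonneg[where f = f, OF n]) (use * p in auto)
  thus "weighted_polynomial_on {0..} l k f I"
    by (intro weighted_polynomial_on_of_poly[where p = p])
      (use p polynomial_weight_bound[OF rank] in auto)
next
  assume f: "weighted_polynomial_on {0..} l k f I"
  show "\<forall>A \<in> psd_mats_rank_le n l I. map_mat f A \<in> psd_mats_rank_le n k UNIV"
    using weighted_polynomial_preserves_rank(2)[OF f] l_ge_2 by simp
qed

end

lemma entrywise_domain_interval:
  fixes R :: ereal
  assumes "0 < R" "2 \<le> l"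
    and I: "I = {x. 0 \<le> x \<and> ereal x < R} \<or> I = {x. - R < ereal x \<and> ereal x < R}"
  shows "entrywise_domain I l"
proof
  show "2 \<le> l" by fact
  have mem: "a \<in> I \<longleftrightarrow> ereal \<bar>a\<bar> < R \<and> (0 \<le> a \<or> (\<exists>c\<in>I. c < 0))" for a
    using I
  proof
    assume I: "I = {x. 0 \<le> x \<and> ereal x < R}"
    thus ?thesis by auto
  next
    assume I: "I = {x. - R < ereal x \<and> ereal x < R}"
    have "x \<in> I \<longleftrightarrow> ereal \<bar>x\<bar> < R" for x
      unfolding I by (cases R) (auto simp: abs_less_iff)
    moreover obtain d where "0 < d" "ereal d < R"
      using ereal_dense2[OF assms(1)] by (auto simp: zero_ereal_def)
    ultimately have "- d \<in> I" "- d < 0" by auto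
    hence "\<exists>c\<in>I. c < 0" by blast
    thus ?thesis using \<open>\<And>x. x \<in> I \<longleftrightarrow> ereal \<bar>x\<bar> < R\<close> by blast
  qed
  show "0 \<in> I" using mem[of 0] assms(1) by (simp add: zero_ereal_def)
  show "b \<in> I" if "a \<in> I" "\<bar>b\<bar> \<le> a" "0 \<le> b \<or> (\<exists>c\<in>I. c < 0)" for a b
  proof -
    have "ereal \<bar>b\<bar> \<le> ereal \<bar>a\<bar>" using that(2) by simp
    thus ?thesis using that mem[of a] mem[of b] by (meson le_less_trans)
  qed
  show "\<exists>b\<in>I. \<bar>a\<bar> < b" if aI: "a \<in> I" for a
  proof -
    obtain b where "\<bar>a\<bar> < b" "ereal b < R"
      using ereal_dense2[of "ereal \<bar>a\<bar>" R] mem[of a] aI by auto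
    thus ?thesis using mem[of b] by (intro bexI[of _ b]) auto
  qed
qed

theorem theorem2:
  fixes R :: ereal and I :: "real set" and n k l :: nat and f :: "real \<Rightarrow> real"
  assumes "0 < R"
    and "I = {x. 0 \<le> x \<and> ereal x < R} \<or> I = {x. - R < ereal x \<and> ereal x < R}"
    and "2 \<le> n" and "k < n - 1" and "2 \<le> l" and "l \<le> n"
  shows
    "(C_k_on k f I \<longrightarrow>
        ((\<forall>A \<in> psd_mats_rank_le n l I. map_mat f A \<in> symmetric_mats_rank_le n k UNIV)
          \<longleftrightarrow> weighted_polynomial_on UNIV l k f I)) \<and>
     (C_k_on k f I \<longrightarrow>
        ((\<forall>A \<in> psd_mats_rank_le n l I. map_mat f A \<in> psd_mats_rank_le n k UNIV)
          \<longleftrightarrow> weighted_polynomial_on {0..} l k f I)) \<and>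
     (I = {x. 0 \<le> x \<and> ereal x < R} \<and> (k = 0 \<or> k + 3 \<le> n) \<longrightarrow>
        ((\<forall>A \<in> psd_mats_rank_le n l I. map_mat f A \<in> psd_mats_rank_le n k UNIV)
          \<longleftrightarrow> weighted_polynomial_on {0..} l k f I))"
proof -
  interpret entrywise_domain I l
    by (rule entrywise_domain_interval[OF assms(1,5,2)])
  have n: "k + 2 \<le> n" using assms(4) by linarith
  show ?thesis
  proof (intro conjI impI)
    assume "C_k_on k f I"
    hence cont: "continuous_on I f" by (rule C_k_on_imp_continuous)
    show "(\<forall>A \<in> psd_mats_rank_le n l I. map_mat f A \<in> symmetric_mats_rank_le n k UNIV)
        \<longleftrightarrow> weighted_polynomial_on UNIV l k f I"
      by (rule rank_preservers[OF n cont])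
    show "(\<forall>A \<in> psd_mats_rank_le n l I. map_mat f A \<in> psd_mats_rank_le n k UNIV)
        \<longleftrightarrow> weighted_polynomial_on {0..} l k f I"
      by (rule psd_rank_preservers[OF n]) (use cont in blast)
  next
    assume "I = {x. 0 \<le> x \<and> ereal x < R} \<and> (k = 0 \<or> k + 3 \<le> n)"
    hence "\<not> (\<exists>c\<in>I. c < 0)" by auto
    thus "(\<forall>A \<in> psd_mats_rank_le n l I. map_mat f A \<in> psd_mats_rank_le n k UNIV)
        \<longleftrightarrow> weighted_polynomial_on {0..} l k f I"
      by (intro psd_rank_preservers[OF n]) blast
  qed
qed

end
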